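(* The category $\mathbf{ContRegFrm}$ of continuous regular frames and proper frame homomorphisms is dually equivalent to the category $\mathbf{LCHaus}$ of locally compact Hausdorff spaces and proper maps.
   Context: A frame is a complete lattice $L$ with $a\wedge\bigvee S=\bigvee\{a\wedge s\mid s\in S\}$ for all $a\in L$, $S\subseteq L$; frame homomorphisms preserve finite meets and arbitrary joins. For $a,b\in L$, $a\ll b$ means: for each $S\subseteq L$, $b\le\bigvee S$ implies $a\le\bigvee T$ for some finite $T\subseteq S$. $L$ is continuous if $a=\bigvee\{x\in L\mid x\ll a\}$ for all $a\in L$. $L$ is regular if $a=\bigvee\{b\in L\mid b^*\vee a=1\}$ for all $a\in L$, where $b^*$ is the pseudocomplement of $b$. A frame homomorphism $h$ is proper if $a\ll b$ implies $h(a)\ll h(b)$. A continuous map $f:X\to Y$ between locally compact Hausdorff spaces is proper if $f^{-1}(K)$ is compact for each compact saturated $K\subseteq Y$ (saturated = intersection of open sets). *)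

theory Defs
  imports "HOL-Analysis.Analysis" "HOL-Algebra.Complete_Lattice"
begin

section \<open>Categories\<close>

text \<open>
  \<open>Comp C X Y Z g f\<close> is the composite \<open>g \<circ> f\<close> of \<open>f : X \<rightarrow> Y\<close> and \<open>g : Y \<rightarrow> Z\<close>. Hom-sets are
  indexed by objects and need not be disjoint, which is why \<open>Comp\<close> (and the arrow part of
  a functor below) takes the objects as arguments.
\<close>

record ('o, 'm) precategory =
  Obj :: "'o set"
  Hom :: "'o \<Rightarrow> 'o \<Rightarrow> 'm set"
  Id :: "'o \<Rightarrow> 'm"
  Comp :: "'o \<Rightarrow> 'o \<Rightarrow> 'o \<Rightarrow> 'm \<Rightarrow> 'm \<Rightarrow> 'm"

locale category =
  fixes C :: "('o, 'm) precategory"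
  assumes Id_in_Hom: "X \<in> Obj C \<Longrightarrow> Id C X \<in> Hom C X X"
    and Comp_in_Hom:
      "\<lbrakk>X \<in> Obj C; Y \<in> Obj C; Z \<in> Obj C; f \<in> Hom C X Y; g \<in> Hom C Y Z\<rbrakk>
        \<Longrightarrow> Comp C X Y Z g f \<in> Hom C X Z"
    and Comp_Id_right:
      "\<lbrakk>X \<in> Obj C; Y \<in> Obj C; f \<in> Hom C X Y\<rbrakk> \<Longrightarrow> Comp C X X Y f (Id C X) = f"
    and Comp_Id_left:
      "\<lbrakk>X \<in> Obj C; Y \<in> Obj C; f \<in> Hom C X Y\<rbrakk> \<Longrightarrow> Comp C X Y Y (Id C Y) f = f"
    and Comp_assoc:
      "\<lbrakk>W \<in> Obj C; X \<in> Obj C; Y \<in> Obj C; Z \<in> Obj C;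
        f \<in> Hom C W X; g \<in> Hom C X Y; h \<in> Hom C Y Z\<rbrakk>
        \<Longrightarrow> Comp C W X Z (Comp C X Y Z h g) f = Comp C W Y Z h (Comp C W X Y g f)"

definition opposite :: "('o, 'm) precategory \<Rightarrow> ('o, 'm) precategory" where
  "opposite C =
     \<lparr>Obj = Obj C,
      Hom = (\<lambda>X Y. Hom C Y X),
      Id = Id C,
      Comp = (\<lambda>X Y Z g f. Comp C Z Y X f g)\<rparr>"

definition isomorphism :: "('o, 'm) precategory \<Rightarrow> 'o \<Rightarrow> 'o \<Rightarrow> 'm \<Rightarrow> bool" where
  "isomorphism C X Y f \<longleftrightarrow>
     f \<in> Hom C X Y \<and>
     (\<exists>g \<in> Hom C Y X. Comp C X Y X g f = Id C X \<and> Comp C Y X Y f g = Id C Y)"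

record ('o, 'm, 'p, 'n) functor_data =
  obj_map :: "'o \<Rightarrow> 'p"
  arr_map :: "'o \<Rightarrow> 'o \<Rightarrow> 'm \<Rightarrow> 'n"

definition is_functor ::
    "('o, 'm) precategory \<Rightarrow> ('p, 'n) precategory \<Rightarrow> ('o, 'm, 'p, 'n) functor_data \<Rightarrow> bool" where
  "is_functor C D F \<longleftrightarrow>
     (\<forall>X \<in> Obj C. obj_map F X \<in> Obj D) \<and>
     (\<forall>X \<in> Obj C. \<forall>Y \<in> Obj C. \<forall>f \<in> Hom C X Y.
        arr_map F X Y f \<in> Hom D (obj_map F X) (obj_map F Y)) \<and>
     (\<forall>X \<in> Obj C. arr_map F X X (Id C X) = Id D (obj_map F X)) \<and>
     (\<forall>X \<in> Obj C. \<forall>Y \<in> Obj C. \<forall>Z \<in> Obj C. \<forall>f \<in> Hom C X Y. \<forall>g \<in> Hom C Y Z.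
        arr_map F X Z (Comp C X Y Z g f) =
        Comp D (obj_map F X) (obj_map F Y) (obj_map F Z) (arr_map F Y Z g) (arr_map F X Y f))"

definition identity_functor :: "('o, 'm, 'o, 'm) functor_data" where
  "identity_functor = \<lparr>obj_map = (\<lambda>X. X), arr_map = (\<lambda>X Y f. f)\<rparr>"

definition compose_functors ::
    "('p, 'n, 'q, 'k) functor_data \<Rightarrow> ('o, 'm, 'p, 'n) functor_data
      \<Rightarrow> ('o, 'm, 'q, 'k) functor_data" where
  "compose_functors G F =
     \<lparr>obj_map = (\<lambda>X. obj_map G (obj_map F X)),
      arr_map = (\<lambda>X Y f. arr_map G (obj_map F X) (obj_map F Y) (arr_map F X Y f))\<rparr>"

definition natural_isomorphism ::
    "('o, 'm) precategory \<Rightarrow> ('p, 'n) precategory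
      \<Rightarrow> ('o, 'm, 'p, 'n) functor_data \<Rightarrow> ('o, 'm, 'p, 'n) functor_data
      \<Rightarrow> ('o \<Rightarrow> 'n) \<Rightarrow> bool" where
  "natural_isomorphism C D F G \<eta> \<longleftrightarrow>
     (\<forall>X \<in> Obj C. isomorphism D (obj_map F X) (obj_map G X) (\<eta> X)) \<and>
     (\<forall>X \<in> Obj C. \<forall>Y \<in> Obj C. \<forall>f \<in> Hom C X Y.
        Comp D (obj_map F X) (obj_map F Y) (obj_map G Y) (\<eta> Y) (arr_map F X Y f) =
        Comp D (obj_map F X) (obj_map G X) (obj_map G Y) (arr_map G X Y f) (\<eta> X))"

definition equivalent_categories ::
    "('o, 'm) precategory \<Rightarrow> ('p, 'n) precategory \<Rightarrow> bool" where
  "equivalent_categories C D \<longleftrightarrow>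
     category C \<and> category D \<and>
     (\<exists>F G \<eta> \<epsilon>. is_functor C D F \<and> is_functor D C G \<and>
        natural_isomorphism C C identity_functor (compose_functors G F) \<eta> \<and>
        natural_isomorphism D D (compose_functors F G) identity_functor \<epsilon>)"

definition dually_equivalent ::
    "('o, 'm) precategory \<Rightarrow> ('p, 'n) precategory \<Rightarrow> bool" where
  "dually_equivalent C D \<longleftrightarrow> equivalent_categories C (opposite D)"


section \<open>Continuous regular frames\<close>

definition is_frame :: "'a gorder \<Rightarrow> bool" where
  "is_frame L \<longleftrightarrow>
     complete_lattice L \<and>
     (\<forall>a \<in> carrier L. \<forall>S. S \<subseteq> carrier L \<longrightarrow>
        a \<sqinter>\<^bsub>L\<^esub> (\<Squnion>\<^bsub>L\<^esub>S) = \<Squnion>\<^bsub>L\<^esub>{a \<sqinter>\<^bsub>L\<^esub> s | s. s \<in> S})"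

definition way_below :: "'a gorder \<Rightarrow> 'a \<Rightarrow> 'a \<Rightarrow> bool" where
  "way_below L a b \<longleftrightarrow>
     (\<forall>S. S \<subseteq> carrier L \<longrightarrow> b \<sqsubseteq>\<^bsub>L\<^esub> \<Squnion>\<^bsub>L\<^esub>S \<longrightarrow>
        (\<exists>T. T \<subseteq> S \<and> finite T \<and> a \<sqsubseteq>\<^bsub>L\<^esub> \<Squnion>\<^bsub>L\<^esub>T))"

definition continuous_frame :: "'a gorder \<Rightarrow> bool" where
  "continuous_frame L \<longleftrightarrow>
     is_frame L \<and>
     (\<forall>a \<in> carrier L. a = \<Squnion>\<^bsub>L\<^esub>{x \<in> carrier L. way_below L x a})"

definition pseudocomplement :: "'a gorder \<Rightarrow> 'a \<Rightarrow> 'a" where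
  "pseudocomplement L b = (SOME c. greatest L c {x \<in> carrier L. b \<sqinter>\<^bsub>L\<^esub> x = \<bottom>\<^bsub>L\<^esub>})"

definition regular_frame :: "'a gorder \<Rightarrow> bool" where
  "regular_frame L \<longleftrightarrow>
     is_frame L \<and>
     (\<forall>a \<in> carrier L.
        a = \<Squnion>\<^bsub>L\<^esub>{b \<in> carrier L. pseudocomplement L b \<squnion>\<^bsub>L\<^esub> a = \<top>\<^bsub>L\<^esub>})"

text \<open>
  Arrows are functions made \<^const>\<open>extensional\<close>, so that arrows agreeing on the carrier are
  equal. Finite meets are the top element and binary meets; the join of the empty set is included.
\<close>

definition frame_hom :: "'a gorder \<Rightarrow> 'b gorder \<Rightarrow> ('a \<Rightarrow> 'b) \<Rightarrow> bool" where
  "frame_hom L M h \<longleftrightarrow>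
     h \<in> carrier L \<rightarrow>\<^sub>E carrier M \<and>
     h \<top>\<^bsub>L\<^esub> = \<top>\<^bsub>M\<^esub> \<and>
     (\<forall>a \<in> carrier L. \<forall>b \<in> carrier L. h (a \<sqinter>\<^bsub>L\<^esub> b) = h a \<sqinter>\<^bsub>M\<^esub> h b) \<and>
     (\<forall>S. S \<subseteq> carrier L \<longrightarrow> h (\<Squnion>\<^bsub>L\<^esub>S) = \<Squnion>\<^bsub>M\<^esub>(h ` S))"

definition proper_frame_hom :: "'a gorder \<Rightarrow> 'b gorder \<Rightarrow> ('a \<Rightarrow> 'b) \<Rightarrow> bool" where
  "proper_frame_hom L M h \<longleftrightarrow>
     frame_hom L M h \<and>
     (\<forall>a \<in> carrier L. \<forall>b \<in> carrier L. way_below L a b \<longrightarrow> way_below M (h a) (h b))"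

definition ContRegFrm :: "('u gorder, 'u \<Rightarrow> 'u) precategory" where
  "ContRegFrm =
     \<lparr>Obj = {L. continuous_frame L \<and> regular_frame L},
      Hom = (\<lambda>L M. {h. proper_frame_hom L M h}),
      Id = (\<lambda>L. \<lambda>x \<in> carrier L. x),
      Comp = (\<lambda>L M N g f. compose (carrier L) g f)\<rparr>"


section \<open>Locally compact Hausdorff spaces\<close>

definition saturatedin :: "'a topology \<Rightarrow> 'a set \<Rightarrow> bool" where
  "saturatedin X K \<longleftrightarrow>
     (\<exists>\<U>. (\<forall>U \<in> \<U>. openin X U) \<and> K = topspace X \<inter> \<Inter>\<U>)"

text \<open>
  Not the library's \<^const>\<open>proper_map\<close>, which means closed with compact fibres and does not
  include continuity.
\<close>

definition proper_continuous_map :: "'a topology \<Rightarrow> 'b topology \<Rightarrow> ('a \<Rightarrow> 'b) \<Rightarrow> bool" where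
  "proper_continuous_map X Y f \<longleftrightarrow>
     continuous_map X Y f \<and>
     (\<forall>K. compactin Y K \<and> saturatedin Y K \<longrightarrow> compactin X {x \<in> topspace X. f x \<in> K})"

text \<open>
  A type \<open>'u\<close> plays the role of the universe: the sets that are small with respect to it are those
  that embed into it. A frame is small if its carrier is; a space \<open>(X, \<tau>)\<close> is small if both \<open>X\<close>
  and \<open>\<tau>\<close> are. Since no type contains a copy of its own power set, the latter condition does not
  follow from \<open>X\<close> being a subset of \<open>'u\<close> and has to be stated. It excludes no space:
  \<open>LCHaus_universe\<close> below shows that every locally compact Hausdorff space has a homeomorphic
  copy in \<open>LCHaus\<close> for every sufficiently large \<open>'u\<close>, for instance \<open>'u = 'a set\<close> for spaces
  over \<open>'a\<close>.
\<close>

definition LCHaus :: "('u topology, 'u \<Rightarrow> 'u) precategory" where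
  "LCHaus =
     \<lparr>Obj = {X. locally_compact_space X \<and> Hausdorff_space X \<and>
                {U. openin X U} \<lesssim> (UNIV :: 'u set)},
      Hom = (\<lambda>X Y. {f \<in> extensional (topspace X). proper_continuous_map X Y f}),
      Id = (\<lambda>X. \<lambda>x \<in> topspace X. x),
      Comp = (\<lambda>X Y Z g f. compose (topspace X) g f)\<rparr>"

lemma LCHaus_universe:
  fixes X :: "'a topology" and e :: "'a set \<Rightarrow> 'u"
  assumes "locally_compact_space X" "Hausdorff_space X" and e: "inj e"
  shows "\<exists>Y \<in> Obj (LCHaus :: ('u topology, 'u \<Rightarrow> 'u) precategory). X homeomorphic_space Y"
proof -
  define j where "j x = e {x}" for x
  have j: "inj j"
    using e by (auto simp: j_def inj_def)
  define p where "p = inv j"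
  have pj: "p (j x) = x" for x
    using j by (simp add: p_def)
  define Y where "Y = pullback_topology (range j) p X"
  have opn: "openin Y U \<longleftrightarrow> (\<exists>V. openin X V \<and> U = p -` V \<inter> range j)" for U
    by (simp add: Y_def openin_pullback_topology)
  have top: "topspace Y = p -` topspace X \<inter> range j"
    by (simp add: Y_def topspace_pullback_topology)
  have "continuous_map Y X (id \<circ> p)"
    unfolding Y_def by (rule continuous_map_pullback) simp
  then have pc: "continuous_map Y X p"
    by simp
  have "p \<circ> j = id"
    by (simp add: fun_eq_iff pj)
  then have jc: "continuous_map X Y j"
    unfolding Y_def by (intro continuous_map_pullback') auto
  have "j (p y) = y" if "y \<in> topspace Y" for y
    using that by (clarsimp simp: top pj)
  then have "homeomorphic_maps X Y j p"
    using pc jc by (simp add: homeomorphic_maps_def pj)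
  then have hom: "X homeomorphic_space Y"
    unfolding homeomorphic_space_def by blast
  have "inj_on (\<lambda>U. e (p ` U)) {U. openin Y U}"
  proof (rule inj_onI)
    fix U V assume UV: "U \<in> {U. openin Y U}" "V \<in> {U. openin Y U}" "e (p ` U) = e (p ` V)"
    have *: "j ` p ` W = W" if "openin Y W" for W
    proof -
      have "W \<subseteq> range j"
        using that unfolding opn by blast
      then have "j (p y) = y" if "y \<in> W" for y
        using that pj by (auto simp: subset_iff image_iff)
      then show ?thesis
        by (simp add: image_image)
    qed
    have "p ` U = p ` V"
      using UV(3) e by (simp add: inj_eq)
    then have "j ` p ` U = j ` p ` V"
      by (rule arg_cong)
    then show "U = V"
      unfolding *[OF UV(1)[unfolded mem_Collect_eq]] *[OF UV(2)[unfolded mem_Collect_eq]] .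
  qed
  then have small: "{U. openin Y U} \<lesssim> (UNIV :: 'u set)"
    unfolding lepoll_def by blast
  have "locally_compact_space Y"
    using homeomorphic_locally_compact_space[OF hom] assms by simp
  moreover have "Hausdorff_space Y"
    using homeomorphic_Hausdorff_space[OF hom] assms by simp
  ultimately show ?thesis
    using small hom
    by (intro bexI[of _ Y]) (simp_all add: LCHaus_def)
qed

end

theory Submission
  imports Defs
begin

text \<open>
  The points of a frame \<open>L\<close> are its prime elements, which already lie in the universe; the open
  sets of the spectrum are \<open>D a = {p. \<not> a \<le> p}\<close>. If \<open>y \<ll> 1\<close> and \<open>c \<or> y = 1\<close>, then the frame of
  elements above \<open>c\<close> is compact, so by Zorn's lemma every \<open>d \<noteq> 1\<close> above \<open>c\<close> lies below a prime.
  Since in a regular frame \<open>x \<ll> y\<close> provides \<open>c\<close> with \<open>x \<and> c = 0\<close> and \<open>c \<or> y = 1\<close>, this shows both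
  that \<open>L\<close> is spatial and that \<open>D x\<close> is contained in a compact set whenever \<open>x \<ll> y \<ll> 1\<close>.
  A proper homomorphism preserves such pairs, and any compact set is covered by finitely many such
  \<open>D x\<close>, so its right adjoint is a proper map of spectra. Conversely, in a locally compact
  Hausdorff space \<open>U \<ll> V\<close> holds iff some compact \<open>K\<close> satisfies \<open>U \<subseteq> K \<subseteq> V\<close>, so preimage along a
  proper map preserves \<open>\<ll>\<close>. The unit \<open>a \<mapsto> D a\<close> is an isomorphism because \<open>L\<close> is spatial, the
  counit \<open>x \<mapsto> X - {x}\<close> because Hausdorff spaces are sober.
\<close>

section \<open>Frames and their spectra\<close>

locale frame = complete_lattice L for L :: "'a gorder" (structure) +
  assumes meet_Sup: "\<lbrakk>a \<in> carrier L; S \<subseteq> carrier L\<rbrakk> \<Longrightarrow> a \<sqinter> \<Squnion>S = \<Squnion>{a \<sqinter> s |s. s \<in> S}"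

lemma is_frame_iff_frame: "is_frame L \<longleftrightarrow> frame L"
  by (auto simp: is_frame_def frame_def frame_axioms_def)

context frame
begin

lemma Sup_le_iff:
  "\<lbrakk>S \<subseteq> carrier L; z \<in> carrier L\<rbrakk> \<Longrightarrow> \<Squnion>S \<sqsubseteq> z \<longleftrightarrow> (\<forall>s\<in>S. s \<sqsubseteq> z)"
  by (meson le_trans subsetD sup_closed sup_least sup_upper)

lemma le_meet_iff:
  "\<lbrakk>x \<in> carrier L; y \<in> carrier L; z \<in> carrier L\<rbrakk> \<Longrightarrow> z \<sqsubseteq> x \<sqinter> y \<longleftrightarrow> z \<sqsubseteq> x \<and> z \<sqsubseteq> y"
  by (meson le_trans meet_closed meet_le meet_left meet_right)

lemma join_le_iff:
  "\<lbrakk>x \<in> carrier L; y \<in> carrier L; z \<in> carrier L\<rbrakk> \<Longrightarrow> x \<squnion> y \<sqsubseteq> z \<longleftrightarrow> x \<sqsubseteq> z \<and> y \<sqsubseteq> z"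
  by (meson join_closed join_le join_left join_right le_trans)

lemma join_mono:
  assumes "x \<sqsubseteq> x'" "y \<sqsubseteq> y'"
    and cl: "x \<in> carrier L" "x' \<in> carrier L" "y \<in> carrier L" "y' \<in> carrier L"
  shows "x \<squnion> y \<sqsubseteq> x' \<squnion> y'"
proof (rule join_le)
  show "x \<sqsubseteq> x' \<squnion> y'" "y \<sqsubseteq> x' \<squnion> y'"
    using le_trans[OF assms(1) join_left[OF cl(2,4)]] le_trans[OF assms(2) join_right[OF cl(2,4)]] cl
    by auto
qed (use cl in auto)

lemma meet_mono:
  assumes "x \<sqsubseteq> x'" "y \<sqsubseteq> y'"
    and cl: "x \<in> carrier L" "x' \<in> carrier L" "y \<in> carrier L" "y' \<in> carrier L"
  shows "x \<sqinter> y \<sqsubseteq> x' \<sqinter> y'"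
proof (rule meet_le)
  show "x \<sqinter> y \<sqsubseteq> x'" "x \<sqinter> y \<sqsubseteq> y'"
    using le_trans[OF meet_left[OF cl(1,3)] assms(1)] le_trans[OF meet_right[OF cl(1,3)] assms(2)] cl
    by auto
qed (use cl in auto)

lemma le_bottom_iff: "x \<in> carrier L \<Longrightarrow> x \<sqsubseteq> \<bottom> \<longleftrightarrow> x = \<bottom>"
  using le_antisym by auto

lemma top_le_iff: "x \<in> carrier L \<Longrightarrow> \<top> \<sqsubseteq> x \<longleftrightarrow> x = \<top>"
  using le_antisym by auto

lemma meet_top: "x \<in> carrier L \<Longrightarrow> x \<sqinter> \<top> = x"
  by (rule le_antisym) (auto simp: le_meet_iff meet_left)

lemma meet_join_distrib:
  assumes "a \<in> carrier L" "b \<in> carrier L" "c \<in> carrier L"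
  shows "a \<sqinter> (b \<squnion> c) = (a \<sqinter> b) \<squnion> (a \<sqinter> c)"
proof -
  have "{a \<sqinter> s |s. s \<in> {b, c}} = {a \<sqinter> b, a \<sqinter> c}"
    by auto
  then show ?thesis
    using meet_Sup[of a "{b, c}"] assms by (simp add: join_def)
qed

text \<open>Distributing \<open>a = a \<sqinter> (p \<squnion> b)\<close> shows that
  \<open>a\<close> lies below \<open>p \<squnion> (a \<sqinter> b)\<close>. Elements that cover
  together with \<open>p\<close> are thus closed under binary meets; this serves both for the
  primality of maximal elements and for intersecting separating elements.\<close>

lemma join_meet_top:
  assumes "p \<in> carrier L" "a \<in> carrier L" "b \<in> carrier L" "p \<squnion> a = \<top>" "p \<squnion> b = \<top>"
  shows "p \<squnion> (a \<sqinter> b) = \<top>"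
proof -
  have "a = a \<sqinter> (p \<squnion> b)"
    using assms by (simp add: meet_top)
  also have "\<dots> = (a \<sqinter> p) \<squnion> (a \<sqinter> b)"
    by (rule meet_join_distrib[OF assms(2,1,3)])
  also have "\<dots> \<sqsubseteq> p \<squnion> (a \<sqinter> b)"
    using assms(1-3) by (intro join_mono) (auto simp: meet_right)
  finally have "p \<squnion> a \<sqsubseteq> p \<squnion> (a \<sqinter> b)"
    using assms(1-3) by (simp add: join_le_iff join_left)
  then show ?thesis
    using assms by (simp add: top_le_iff)
qed

text \<open>The join of all elements disjoint from \<open>b\<close> is itself disjoint from
  \<open>b\<close> by the frame law, so the choice in \<open>pseudocomplement\<close> picks an
  existing greatest element.\<close>

lemma pseudocomplement_greatest:
  assumes b: "b \<in> carrier L"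
  shows "greatest L (pseudocomplement L b) {x \<in> carrier L. b \<sqinter> x = \<bottom>}"
proof -
  let ?A = "{x \<in> carrier L. b \<sqinter> x = \<bottom>}"
  have "b \<sqinter> \<Squnion>?A = \<Squnion>{b \<sqinter> s |s. s \<in> ?A}"
    using b by (intro meet_Sup) auto
  also have "\<dots> \<sqsubseteq> \<bottom>"
    using b by (subst Sup_le_iff) auto
  finally have "b \<sqinter> \<Squnion>?A = \<bottom>"
    using b by (subst (asm) le_bottom_iff) auto
  then have "greatest L (\<Squnion>?A) ?A"
    unfolding greatest_def by (auto intro!: sup_upper)
  then show ?thesis
    unfolding pseudocomplement_def by (rule someI)
qed

lemma pseudocomplement_closed [simp]: "b \<in> carrier L \<Longrightarrow> pseudocomplement L b \<in> carrier L"
  and meet_pseudocomplement: "b \<in> carrier L \<Longrightarrow> b \<sqinter> pseudocomplement L b = \<bottom>"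
  and le_pseudocomplement:
    "\<lbrakk>b \<in> carrier L; x \<in> carrier L; b \<sqinter> x = \<bottom>\<rbrakk> \<Longrightarrow> x \<sqsubseteq> pseudocomplement L b"
  using pseudocomplement_greatest[of b] by (auto simp: greatest_def)

text \<open>Every \<open>c\<close> disjoint from \<open>b\<close> lies below the pseudocomplement.
  Regularity can therefore be used and verified with an arbitrary separating element
  \<open>c\<close>.\<close>

lemma pseudocomplement_join_top_iff:
  assumes "a \<in> carrier L" "b \<in> carrier L"
  shows "pseudocomplement L b \<squnion> a = \<top> \<longleftrightarrow> (\<exists>c\<in>carrier L. b \<sqinter> c = \<bottom> \<and> c \<squnion> a = \<top>)"
proof
  assume "pseudocomplement L b \<squnion> a = \<top>"
  then show "\<exists>c\<in>carrier L. b \<sqinter> c = \<bottom> \<and> c \<squnion> a = \<top>"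
    using assms meet_pseudocomplement by (intro bexI[of _ "pseudocomplement L b"]) auto
next
  assume "\<exists>c\<in>carrier L. b \<sqinter> c = \<bottom> \<and> c \<squnion> a = \<top>"
  then obtain c where c: "c \<in> carrier L" "b \<sqinter> c = \<bottom>" "c \<squnion> a = \<top>" by auto
  then have "c \<squnion> a \<sqsubseteq> pseudocomplement L b \<squnion> a"
    using assms le_pseudocomplement[of b c] by (intro join_mono) auto
  then show "pseudocomplement L b \<squnion> a = \<top>"
    using assms c by (simp add: top_le_iff)
qed

lemma way_belowE:
  assumes "way_below L a b" "S \<subseteq> carrier L" "b \<sqsubseteq> \<Squnion>S"
  obtains T where "T \<subseteq> S" "finite T" "T \<subseteq> carrier L" "\<Squnion>T \<in> carrier L" "a \<sqsubseteq> \<Squnion>T"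
proof -
  obtain T where T: "T \<subseteq> S \<and> finite T \<and> a \<sqsubseteq> \<Squnion>T"
    using assms unfolding way_below_def by meson
  then have "T \<subseteq> carrier L"
    using assms by auto
  with T show ?thesis
    using that[of T] sup_closed[of T] by simp
qed

lemma way_below_mono:
  assumes "way_below L x y" "x' \<sqsubseteq> x" "y \<sqsubseteq> y'"
    "x \<in> carrier L" "y \<in> carrier L" "x' \<in> carrier L" "y' \<in> carrier L"
  shows "way_below L x' y'"
  unfolding way_below_def
proof (intro allI impI)
  fix S assume S: "S \<subseteq> carrier L" "y' \<sqsubseteq> \<Squnion>S"
  then have "y \<sqsubseteq> \<Squnion>S"
    using assms le_trans[of y y' "\<Squnion>S"] by auto
  then obtain T where T: "T \<subseteq> S" "finite T" "\<Squnion>T \<in> carrier L" "x \<sqsubseteq> \<Squnion>T"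
    using way_belowE[OF assms(1) S(1)] by metis
  then have "x' \<sqsubseteq> \<Squnion>T"
    using assms(2,4,6) le_trans[of x' x "\<Squnion>T"] by simp
  with T show "\<exists>T\<subseteq>S. finite T \<and> x' \<sqsubseteq> \<Squnion>T" by auto
qed

lemma way_below_imp_le:
  assumes "way_below L x y" "x \<in> carrier L" "y \<in> carrier L"
  shows "x \<sqsubseteq> y"
proof -
  obtain T where "T \<subseteq> {y}" "x \<sqsubseteq> \<Squnion>T" "\<Squnion>T \<in> carrier L"
    by (rule way_belowE[OF assms(1), of "{y}"]) (use assms(3) in \<open>simp_all add: that\<close>)
  moreover have "\<Squnion>T \<sqsubseteq> y"
    using \<open>T \<subseteq> {y}\<close> assms by (subst Sup_le_iff) auto
  ultimately show ?thesis
    using assms le_trans[of x "\<Squnion>T" y] by auto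
qed

end

section \<open>Prime elements and the topology on them\<close>

definition prime_elements :: "'a gorder \<Rightarrow> 'a set" where
  "prime_elements L = {p \<in> carrier L. p \<noteq> \<top>\<^bsub>L\<^esub> \<and>
     (\<forall>a\<in>carrier L. \<forall>b\<in>carrier L. a \<sqinter>\<^bsub>L\<^esub> b \<sqsubseteq>\<^bsub>L\<^esub> p \<longrightarrow> a \<sqsubseteq>\<^bsub>L\<^esub> p \<or> b \<sqsubseteq>\<^bsub>L\<^esub> p)}"

definition basic_open :: "'a gorder \<Rightarrow> 'a \<Rightarrow> 'a set" where
  "basic_open L a = {p \<in> prime_elements L. \<not> a \<sqsubseteq>\<^bsub>L\<^esub> p}"

definition spectrum :: "'a gorder \<Rightarrow> 'a topology" where
  "spectrum L = topology (\<lambda>U. \<exists>a\<in>carrier L. U = basic_open L a)"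

context frame
begin

lemma prime_closed: "p \<in> prime_elements L \<Longrightarrow> p \<in> carrier L"
  by (simp add: prime_elements_def)

lemma basic_open_bottom: "basic_open L \<bottom> = {}"
  by (auto simp: basic_open_def prime_closed)

lemma basic_open_top: "basic_open L \<top> = prime_elements L"
  by (auto simp: basic_open_def prime_elements_def top_le_iff)

lemma basic_open_meet:
  assumes "a \<in> carrier L" "b \<in> carrier L"
  shows "basic_open L (a \<sqinter> b) = basic_open L a \<inter> basic_open L b"
proof -
  have "a \<sqinter> b \<sqsubseteq> p \<longleftrightarrow> a \<sqsubseteq> p \<or> b \<sqsubseteq> p" if "p \<in> prime_elements L" for p
    using that assms le_trans[OF meet_left, of a b p] le_trans[OF meet_right, of a b p]
    by (auto simp: prime_elements_def)
  then show ?thesis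
    by (auto simp: basic_open_def)
qed

lemma basic_open_Sup:
  assumes "S \<subseteq> carrier L"
  shows "basic_open L (\<Squnion>S) = (\<Union>s\<in>S. basic_open L s)"
  using assms by (fastforce simp: basic_open_def prime_closed Sup_le_iff)

lemma basic_open_mono:
  "\<lbrakk>a \<sqsubseteq> b; a \<in> carrier L; b \<in> carrier L\<rbrakk> \<Longrightarrow> basic_open L a \<subseteq> basic_open L b"
  using le_trans[of a b] by (auto simp: basic_open_def dest: prime_closed)

text \<open>The sets \<open>basic_open L a\<close> are closed under binary intersections and
  arbitrary unions, by \<open>basic_open_meet\<close> and \<open>basic_open_Sup\<close>, so they
  already form a topology and not only a base of one.\<close>

lemma openin_spectrum: "openin (spectrum L) U \<longleftrightarrow> (\<exists>a\<in>carrier L. U = basic_open L a)"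
proof -
  have "istopology (\<lambda>U. \<exists>a\<in>carrier L. U = basic_open L a)"
    unfolding istopology_def
  proof (intro conjI allI impI)
    fix U V assume "\<exists>a\<in>carrier L. U = basic_open L a" "\<exists>a\<in>carrier L. V = basic_open L a"
    then show "\<exists>a\<in>carrier L. U \<inter> V = basic_open L a"
      using basic_open_meet by (metis meet_closed)
  next
    fix \<K> assume "\<forall>K\<in>\<K>. \<exists>a\<in>carrier L. K = basic_open L a"
    then obtain f where f: "\<And>K. K \<in> \<K> \<Longrightarrow> f K \<in> carrier L \<and> K = basic_open L (f K)"
      by metis
    then have "\<Union>\<K> = basic_open L (\<Squnion>(f ` \<K>))"
      by (subst basic_open_Sup) auto
    moreover have "\<Squnion>(f ` \<K>) \<in> carrier L"
      using f by (intro sup_closed) auto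
    ultimately show "\<exists>a\<in>carrier L. \<Union>\<K> = basic_open L a" by blast
  qed
  then show ?thesis
    by (simp add: spectrum_def topology_inverse')
qed

lemma openin_basic_open [simp]: "a \<in> carrier L \<Longrightarrow> openin (spectrum L) (basic_open L a)"
  by (auto simp: openin_spectrum)

lemma topspace_spectrum [simp]: "topspace (spectrum L) = prime_elements L"
proof
  show "topspace (spectrum L) \<subseteq> prime_elements L"
    using openin_topspace[of "spectrum L"] unfolding openin_spectrum basic_open_def by blast
  show "prime_elements L \<subseteq> topspace (spectrum L)"
    using openin_basic_open[OF top_closed] openin_subset by (metis basic_open_top)
qed

text \<open>This is the smallness condition in \<open>LCHaus\<close>; it holds because
  \<open>basic_open L\<close> maps the carrier onto the open sets.\<close>

lemma lepoll_opens_spectrum: "{U. openin (spectrum L) U} \<lesssim> (UNIV :: 'a set)"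
proof -
  have "{U. openin (spectrum L) U} = basic_open L ` carrier L"
    by (auto simp: openin_spectrum)
  then show ?thesis
    by (metis image_lepoll lepoll_trans subset_UNIV subset_imp_lepoll)
qed

text \<open>If neither \<open>a\<close> nor \<open>b\<close> is below \<open>p\<close>, maximality
  makes both \<open>p \<squnion> a\<close> and \<open>p \<squnion> b\<close> the top, hence also
  \<open>p \<squnion> (a \<sqinter> b)\<close> by \<open>join_meet_top\<close>. This is impossible
  when \<open>a \<sqinter> b\<close> is below \<open>p\<close>.\<close>

lemma maximal_imp_prime:
  assumes p: "p \<in> carrier L" "p \<noteq> \<top>" and max: "\<And>q. \<lbrakk>q \<in> carrier L; p \<sqsubseteq> q; q \<noteq> \<top>\<rbrakk> \<Longrightarrow> q = p"
  shows "p \<in> prime_elements L"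
  unfolding prime_elements_def mem_Collect_eq
proof (intro conjI ballI impI p)
  have top: "p \<squnion> a = \<top>" if "a \<in> carrier L" "\<not> a \<sqsubseteq> p" for a
    using max[of "p \<squnion> a"] that p by (metis join_closed join_left join_right)
  fix a b assume ab: "a \<in> carrier L" "b \<in> carrier L" "a \<sqinter> b \<sqsubseteq> p"
  show "a \<sqsubseteq> p \<or> b \<sqsubseteq> p"
  proof (rule ccontr)
    assume "\<not> (a \<sqsubseteq> p \<or> b \<sqsubseteq> p)"
    then have "p \<squnion> (a \<sqinter> b) = \<top>"
      using ab p top by (intro join_meet_top) auto
    moreover have "p \<squnion> (a \<sqinter> b) \<sqsubseteq> p"
      using ab p by (simp add: join_le_iff)
    ultimately show False
      using p top_le_iff by simp
  qed
qed

text \<open>If \<open>y \<ll> \<top>\<close> and \<open>c \<squnion> y = \<top>\<close>, the frame of elements above \<open>c\<close> is compact, so Zorn's lemma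
  yields maximal, hence prime, elements in it.\<close>

lemma ex_prime_above:
  assumes y: "y \<in> carrier L" "way_below L y \<top>" and c: "c \<in> carrier L" "c \<squnion> y = \<top>"
    and d: "d \<in> carrier L" "c \<sqsubseteq> d" "d \<noteq> \<top>"
  shows "\<exists>p\<in>prime_elements L. d \<sqsubseteq> p"
proof -
  define A where "A = {q \<in> carrier L. d \<sqsubseteq> q \<and> q \<noteq> \<top>}"
  \<comment> \<open>Members of \<open>A\<close> lie above \<open>c\<close>; one that also lay above
    \<open>y\<close> would lie above \<open>c \<squnion> y = \<top>\<close>.\<close>
  have not_le: "\<not> y \<sqsubseteq> q" if "q \<in> A" for q
  proof
    assume "y \<sqsubseteq> q"
    moreover have "c \<sqsubseteq> q"
      using that c d le_trans[of c d q] by (auto simp: A_def)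
    ultimately have "c \<squnion> y \<sqsubseteq> q"
      using that y c by (intro join_le) (auto simp: A_def)
    then show False
      using that c by (auto simp: A_def top_le_iff)
  qed
  define r where "r = {(x, y). x \<in> A \<and> y \<in> A \<and> x \<sqsubseteq> y}"
  have AL: "A \<subseteq> carrier L"
    by (auto simp: A_def)
  have refl: "(x, x) \<in> r" if "x \<in> A" for x
    using AL that by (auto simp: r_def)
  have "Field r \<subseteq> A"
    by (auto simp: Field_def r_def)
  moreover have "A \<subseteq> Field r"
    using refl by (auto simp: Field_def)
  ultimately have F: "Field r = A" ..
  have "refl_on A r" "r \<subseteq> A \<times> A"
    using AL by (auto simp: refl_on_def r_def)
  moreover have "trans r"
  proof (rule transI)
    fix x y z assume "(x, y) \<in> r" "(y, z) \<in> r"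
    then show "(x, z) \<in> r"
      using AL le_trans[of x y z] by (auto simp: r_def)
  qed
  moreover have "antisym r"
  proof (rule antisymI)
    fix x y assume "(x, y) \<in> r" "(y, x) \<in> r"
    then show "x = y"
      using AL le_antisym[of x y] by (auto simp: r_def)
  qed
  ultimately have r: "Partial_order r" "Field r = A"
    unfolding F partial_order_on_def preorder_on_def by auto
  have "\<exists>m\<in>Field r. \<forall>a\<in>Field r. (m, a) \<in> r \<longrightarrow> a = m"
  proof (rule Zorns_po_lemma[OF r(1)])
    fix C assume C: "C \<in> Chains r"
    then have CA: "C \<subseteq> A"
      by (auto simp: Chains_def r_def)
    then have CL: "C \<subseteq> carrier L"
      by (auto simp: A_def)
    show "\<exists>u\<in>Field r. \<forall>a\<in>C. (a, u) \<in> r"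
    proof (cases "C = {}")
      case True
      then show ?thesis
        using d r(2) by (auto simp: A_def)
    next
      case False
      \<comment> \<open>If the chain joined to the top, \<open>y\<close> would lie below a finite
        subjoin, hence below a single member of the chain, against \<open>not_le\<close>.\<close>
      have "\<Squnion>C \<noteq> \<top>"
      proof
        assume "\<Squnion>C = \<top>"
        then obtain T where T: "T \<subseteq> C" "finite T" "y \<sqsubseteq> \<Squnion>T"
          using way_belowE[OF y(2) CL] by (metis le_refl top_closed)
        \<comment> \<open>A finite subset of a chain is bounded by a member of the chain;
          \<open>C\<close> being nonempty supplies the bound for empty \<open>T\<close>.\<close>
        have "\<exists>q\<in>C. \<forall>t\<in>T. t \<sqsubseteq> q"
          using T(2,1)
        proof (induction T)
          case empty
          then show ?case using False by auto
        next
          case (insert t T)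
          then obtain q where q: "q \<in> C" "\<forall>t\<in>T. t \<sqsubseteq> q" by auto
          have tq: "t \<in> carrier L" "q \<in> carrier L"
            using q insert.prems CL by auto
          have "t \<sqsubseteq> q \<or> q \<sqsubseteq> t"
            using C q insert.prems unfolding Chains_def r_def by auto
          then show ?case
          proof
            assume "t \<sqsubseteq> q"
            with q show ?thesis by auto
          next
            assume qt: "q \<sqsubseteq> t"
            have "s \<sqsubseteq> t" if "s \<in> T" for s
              using le_trans[OF _ qt, of s] q(2) that tq insert.prems CL by auto
            with tq insert.prems show ?thesis by auto
          qed
        qed
        then obtain q where q: "q \<in> C" "\<forall>t\<in>T. t \<sqsubseteq> q" by auto
        then have "\<Squnion>T \<sqsubseteq> q"
          using T CL by (intro sup_least) auto
        then have "y \<sqsubseteq> q"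
          using le_trans[of y "\<Squnion>T" q] T(1,3) q(1) CL y(1) sup_closed[of T] by auto
        then show False
          using not_le q(1) CA by auto
      qed
      moreover have "d \<sqsubseteq> \<Squnion>C"
      proof -
        obtain q where "q \<in> C" using False by auto
        then show ?thesis
          using CA CL d(1) le_trans[of d q "\<Squnion>C"] sup_upper[of C q] by (auto simp: A_def)
      qed
      ultimately have "\<Squnion>C \<in> A"
        using CL by (auto simp: A_def)
      then show ?thesis
        using r(2) CA CL by (auto simp: r_def intro!: bexI[of _ "\<Squnion>C"] sup_upper)
    qed
  qed
  then obtain p where p: "p \<in> A" "\<And>q. \<lbrakk>q \<in> A; p \<sqsubseteq> q\<rbrakk> \<Longrightarrow> q = p"
    unfolding r(2) by (auto simp: r_def)
  have "p \<in> prime_elements L"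
  proof (rule maximal_imp_prime)
    fix q assume q: "q \<in> carrier L" "p \<sqsubseteq> q" "q \<noteq> \<top>"
    then have "q \<in> A"
      using p(1) d le_trans[of d p q] by (auto simp: A_def)
    then show "q = p" using p(2) q by auto
  qed (use p in \<open>auto simp: A_def\<close>)
  then show ?thesis
    using p(1) by (auto simp: A_def)
qed

end

section \<open>Continuous regular frames: spatiality, and topological properties of the
  spectrum\<close>

locale continuous_regular_frame = frame +
  assumes eq_Sup_way_below: "a \<in> carrier L \<Longrightarrow> a = \<Squnion>{x \<in> carrier L. way_below L x a}"
    and eq_Sup_well_inside:
      "a \<in> carrier L \<Longrightarrow> a = \<Squnion>{b \<in> carrier L. pseudocomplement L b \<squnion> a = \<top>}"

lemma ContRegFrm_Obj_iff: "L \<in> Obj ContRegFrm \<longleftrightarrow> continuous_regular_frame L"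
  by (auto simp: ContRegFrm_def continuous_frame_def regular_frame_def is_frame_iff_frame
      continuous_regular_frame_def continuous_regular_frame_axioms_def)

context continuous_regular_frame
begin

text \<open>\<open>a\<close> is the join of the elements way below it, so these cannot all lie below
  \<open>b\<close>.\<close>

lemma ex_way_below:
  assumes "a \<in> carrier L" "b \<in> carrier L" "\<not> a \<sqsubseteq> b"
  obtains x where "x \<in> carrier L" "way_below L x a" "\<not> x \<sqsubseteq> b"
proof -
  have "\<not> \<Squnion>{x \<in> carrier L. way_below L x a} \<sqsubseteq> b"
    using assms eq_Sup_way_below[of a] by simp
  then show ?thesis
    using assms that by (subst (asm) Sup_le_iff) auto
qed

lemma ex_well_inside:
  assumes "a \<in> carrier L" "b \<in> carrier L" "\<not> a \<sqsubseteq> b"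
  obtains x c where "x \<in> carrier L" "c \<in> carrier L" "x \<sqinter> c = \<bottom>" "c \<squnion> a = \<top>" "\<not> x \<sqsubseteq> b"
proof -
  have "\<not> \<Squnion>{b \<in> carrier L. pseudocomplement L b \<squnion> a = \<top>} \<sqsubseteq> b"
    using assms eq_Sup_well_inside[of a] by simp
  then show ?thesis
    using assms that by (subst (asm) Sup_le_iff) (auto simp: pseudocomplement_join_top_iff)
qed

text \<open>By regularity \<open>y\<close> is the join of \<open>B\<close>, so \<open>x\<close> lies
  below the join of a finite \<open>T\<close> contained in \<open>B\<close>. The finitely many
  elements separating the members of \<open>T\<close> from \<open>y\<close> can be met to a single
  \<open>c\<close>.\<close>

lemma way_below_imp_well_inside:
  assumes "way_below L x y" "x \<in> carrier L" "y \<in> carrier L"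
  obtains c where "c \<in> carrier L" "x \<sqinter> c = \<bottom>" "c \<squnion> y = \<top>"
proof -
  define B where "B = {b \<in> carrier L. pseudocomplement L b \<squnion> y = \<top>}"
  have B: "B \<subseteq> carrier L"
    by (auto simp: B_def)
  have "\<Squnion>B = y"
    unfolding B_def by (rule eq_Sup_well_inside[OF assms(3), symmetric])
  then have "y \<sqsubseteq> \<Squnion>B"
    using assms(3) by simp
  then obtain T where T: "T \<subseteq> B" "finite T" "x \<sqsubseteq> \<Squnion>T"
    using way_belowE[OF assms(1) B] by metis
  \<comment> \<open>The induction starts with \<open>c = \<top>\<close> and meets \<open>c\<close>
    with one pseudocomplement at a time; \<open>join_meet_top\<close> keeps
    \<open>c \<squnion> y = \<top>\<close>.\<close>
  have "\<exists>c\<in>carrier L. (\<forall>t\<in>T. c \<sqinter> t = \<bottom>) \<and> c \<squnion> y = \<top>"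
    using T(2,1)
  proof (induction T)
    case empty
    have "\<top> \<squnion> y = \<top>"
      using assms(3) by (metis join_closed join_left top_closed top_le_iff)
    then show ?case by auto
  next
    case (insert t T)
    then obtain c where c: "c \<in> carrier L" "\<And>t. t \<in> T \<Longrightarrow> c \<sqinter> t = \<bottom>" "c \<squnion> y = \<top>" by auto
    have t: "t \<in> carrier L" "pseudocomplement L t \<squnion> y = \<top>"
      using insert.prems by (auto simp: B_def)
    define d where "d = c \<sqinter> pseudocomplement L t"
    have d: "d \<in> carrier L" "d \<sqsubseteq> c" "d \<sqsubseteq> pseudocomplement L t"
      using c t by (auto simp: d_def meet_left meet_right)
    have "d \<sqinter> t \<sqsubseteq> t \<sqinter> pseudocomplement L t"
      using d t by (subst meet_comm) (auto intro: meet_mono)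
    then have "d \<sqinter> t = \<bottom>"
      using d t by (simp add: meet_pseudocomplement le_bottom_iff)
    moreover have "d \<sqinter> s = \<bottom>" if "s \<in> T" for s
    proof -
      have s: "s \<in> carrier L" using that insert.prems by (auto simp: B_def)
      have "d \<sqinter> s \<sqsubseteq> c \<sqinter> s"
        using d s c by (intro meet_mono) auto
      then show ?thesis
        using c(2)[OF that] d s by (simp add: le_bottom_iff)
    qed
    moreover have "d \<squnion> y = \<top>"
      using c t assms(3) join_meet_top[of y c "pseudocomplement L t"]
      by (simp add: d_def join_comm)
    ultimately show ?case
      using d by auto
  qed
  then obtain c where c: "c \<in> carrier L" "\<And>t. t \<in> T \<Longrightarrow> c \<sqinter> t = \<bottom>" "c \<squnion> y = \<top>" by auto
  have TL: "T \<subseteq> carrier L"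
    using T by (auto simp: B_def)
  \<comment> \<open>The frame law extends disjointness from the members of \<open>T\<close> to their
    join, and \<open>x\<close> lies below that join.\<close>
  have "c \<sqinter> \<Squnion>T = \<Squnion>{c \<sqinter> t |t. t \<in> T}"
    using c TL by (intro meet_Sup)
  also have "\<dots> \<sqsubseteq> \<bottom>"
    using c TL by (subst Sup_le_iff) auto
  finally have "c \<sqinter> \<Squnion>T \<sqsubseteq> \<bottom>" .
  moreover have "x \<sqinter> c \<sqsubseteq> c \<sqinter> \<Squnion>T"
    using c TL T assms(2) by (subst meet_comm) (auto intro: meet_mono)
  ultimately have "x \<sqinter> c \<sqsubseteq> \<bottom>"
    using c TL assms(2) le_trans[of "x \<sqinter> c" "c \<sqinter> \<Squnion>T" \<bottom>] by auto
  then have "x \<sqinter> c = \<bottom>"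
    using c assms(2) by (simp add: le_bottom_iff)
  with c show ?thesis
    using that by blast
qed

text \<open>Take \<open>w\<close> way below \<open>y\<close> and \<open>y\<close> way below
  \<open>a\<close> with \<open>w\<close> not below \<open>b\<close>, and let \<open>c\<close>
  separate \<open>w\<close> from \<open>y\<close>. Then \<open>b \<squnion> c\<close> is not the
  top, since otherwise \<open>w = (w \<sqinter> b) \<squnion> (w \<sqinter> c)\<close> would lie
  below \<open>b\<close>. A prime above \<open>b \<squnion> c\<close> cannot lie above
  \<open>a\<close>, because it would then lie above \<open>c \<squnion> y = \<top>\<close>.\<close>

lemma spatial:
  assumes a: "a \<in> carrier L" and b: "b \<in> carrier L" and "\<not> a \<sqsubseteq> b"
  shows "\<exists>p\<in>prime_elements L. b \<sqsubseteq> p \<and> \<not> a \<sqsubseteq> p"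
proof -
  obtain y where y: "y \<in> carrier L" "way_below L y a" "\<not> y \<sqsubseteq> b"
    using ex_way_below assms by metis
  obtain w where w: "w \<in> carrier L" "way_below L w y" "\<not> w \<sqsubseteq> b"
    using ex_way_below y b by metis
  obtain c where c: "c \<in> carrier L" "w \<sqinter> c = \<bottom>" "c \<squnion> y = \<top>"
    using way_below_imp_well_inside[OF w(2,1) y(1)] .
  have ya: "y \<sqsubseteq> a" "way_below L y \<top>"
    using way_below_imp_le[of y a] way_below_mono[of y a y \<top>] y a by auto
  have "b \<squnion> c \<noteq> \<top>"
  proof
    assume "b \<squnion> c = \<top>"
    then have "w = w \<sqinter> (b \<squnion> c)"
      using w by (simp add: meet_top)
    also have "\<dots> = (w \<sqinter> b) \<squnion> \<bottom>"
      using w b c by (simp add: meet_join_distrib)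
    also have "\<dots> \<sqsubseteq> b"
      using w b by (simp add: join_le_iff meet_right)
    finally show False
      using w by simp
  qed
  then obtain p where p: "p \<in> prime_elements L" "b \<squnion> c \<sqsubseteq> p"
    using ex_prime_above[OF y(1) ya(2) c(1,3), of "b \<squnion> c"] b c by (auto simp: join_right)
  have pL: "p \<in> carrier L" "p \<noteq> \<top>"
    using p by (auto simp: prime_elements_def)
  have "b \<sqsubseteq> p" "c \<sqsubseteq> p"
    using p b c pL by (auto simp: join_le_iff)
  moreover have "\<not> a \<sqsubseteq> p"
  proof
    assume "a \<sqsubseteq> p"
    then have "c \<squnion> y \<sqsubseteq> p"
      using \<open>c \<sqsubseteq> p\<close> ya y a c pL le_trans[of y a p] by (intro join_le) auto
    then show False
      using c pL by (simp add: top_le_iff)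
  qed
  ultimately show ?thesis
    using p(1) by blast
qed

text \<open>Spatiality gives the nontrivial direction: a prime above \<open>b\<close> but not above
  \<open>a\<close> would lie in \<open>basic_open L a\<close> only. Hence the unit is an order
  embedding.\<close>

lemma le_iff_basic_open_subset:
  assumes "a \<in> carrier L" "b \<in> carrier L"
  shows "a \<sqsubseteq> b \<longleftrightarrow> basic_open L a \<subseteq> basic_open L b"
proof
  assume "basic_open L a \<subseteq> basic_open L b"
  then show "a \<sqsubseteq> b"
    using spatial[OF assms] unfolding basic_open_def by blast
qed (use basic_open_mono assms in auto)

text \<open>Of two distinct primes, one is not below the other, say \<open>p\<close> not below
  \<open>q\<close>. Regularity gives \<open>x\<close> not below \<open>q\<close> and a
  \<open>c\<close> disjoint from \<open>x\<close> with \<open>c \<squnion> p = \<top>\<close>. Then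
  \<open>c\<close> is not below \<open>p\<close>, and the disjoint sets
  \<open>basic_open L c\<close> and \<open>basic_open L x\<close> separate \<open>p\<close> from
  \<open>q\<close>.\<close>

lemma Hausdorff_spectrum: "Hausdorff_space (spectrum L)"
proof -
  have sep: "\<exists>U V. openin (spectrum L) U \<and> openin (spectrum L) V \<and> p \<in> U \<and> q \<in> V \<and> disjnt U V"
    if p: "p \<in> prime_elements L" and q: "q \<in> prime_elements L" and pq: "\<not> p \<sqsubseteq> q" for p q
  proof -
    obtain x c where xc: "x \<in> carrier L" "c \<in> carrier L" "x \<sqinter> c = \<bottom>" "c \<squnion> p = \<top>" "\<not> x \<sqsubseteq> q"
      using ex_well_inside[OF prime_closed[OF p] prime_closed[OF q] pq] by metis
    have "\<not> c \<sqsubseteq> p"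
    proof
      assume "c \<sqsubseteq> p"
      then have "c \<squnion> p \<sqsubseteq> p"
        using p xc(2) by (intro join_le) (auto simp: prime_closed)
      then show False
        using p xc by (simp add: prime_elements_def top_le_iff)
    qed
    moreover have "disjnt (basic_open L c) (basic_open L x)"
      using basic_open_meet[OF xc(1,2)] xc(3) by (auto simp: disjnt_def basic_open_bottom)
    ultimately have "p \<in> basic_open L c" "q \<in> basic_open L x"
        "disjnt (basic_open L c) (basic_open L x)"
      using xc p q by (auto simp: basic_open_def)
    with openin_basic_open[OF xc(2)] openin_basic_open[OF xc(1)] show ?thesis
      by blast
  qed
  show ?thesis
    unfolding Hausdorff_space_def topspace_spectrum
  proof (intro allI impI)
    fix p q assume pq: "p \<in> prime_elements L \<and> q \<in> prime_elements L \<and> p \<noteq> q"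
    then have "\<not> p \<sqsubseteq> q \<or> \<not> q \<sqsubseteq> p"
      using le_antisym prime_closed by blast
    then show "\<exists>U V. openin (spectrum L) U \<and> openin (spectrum L) V \<and> p \<in> U \<and> q \<in> V \<and> disjnt U V"
      using sep[of p q] sep[of q p] pq by (metis disjnt_sym)
  qed
qed

text \<open>For a cover of this closed set by basic opens, the join of \<open>c\<close> and the
  covering elements must be the top: a prime above it, as given by \<open>ex_prime_above\<close>,
  would be an uncovered point. As \<open>y\<close> is way below the top, finitely many of these
  elements suffice to dominate \<open>y\<close>, and no prime above \<open>c\<close> lies above
  \<open>y\<close>.\<close>

lemma compactin_above:
  assumes y: "y \<in> carrier L" "way_below L y \<top>" and c: "c \<in> carrier L" "c \<squnion> y = \<top>"
  shows "compactin (spectrum L) {p \<in> prime_elements L. c \<sqsubseteq> p}"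
  unfolding compactin_def topspace_spectrum
proof (intro conjI allI impI)
  fix \<U> assume \<U>: "(\<forall>U\<in>\<U>. openin (spectrum L) U) \<and> {p \<in> prime_elements L. c \<sqsubseteq> p} \<subseteq> \<Union>\<U>"
  then obtain f where f: "\<And>U. U \<in> \<U> \<Longrightarrow> f U \<in> carrier L \<and> U = basic_open L (f U)"
    unfolding openin_spectrum by metis
  define d where "d = \<Squnion>(insert c (f ` \<U>))"
  have sub: "insert c (f ` \<U>) \<subseteq> carrier L"
    using f c by auto
  have d: "d \<in> carrier L" "c \<sqsubseteq> d" "\<And>U. U \<in> \<U> \<Longrightarrow> f U \<sqsubseteq> d"
    using sub by (auto simp: d_def intro: sup_upper)
  have "d = \<top>"
  proof (rule ccontr)
    assume "d \<noteq> \<top>"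
    then obtain p where p: "p \<in> prime_elements L" "d \<sqsubseteq> p"
      using ex_prime_above[OF y c] d by auto
    have "c \<sqsubseteq> p"
      using p d c le_trans[of c d p] prime_closed by auto
    then obtain U where U: "U \<in> \<U>" "p \<in> U"
      using \<U> p by auto
    then have "\<not> f U \<sqsubseteq> p"
      using f by (auto simp: basic_open_def)
    then show False
      using le_trans[of "f U" d p] d U f p prime_closed by auto
  qed
  then obtain T where T: "T \<subseteq> insert c (f ` \<U>)" "finite T" "y \<sqsubseteq> \<Squnion>T"
    using way_belowE[OF y(2) sub] by (metis d_def le_refl top_closed)
  \<comment> \<open>\<open>T\<close> may contain \<open>c\<close>, which does not come from the
    cover; discarding it is harmless because every point considered lies above
    \<open>c\<close>.\<close>
  have "T - {c} \<subseteq> f ` \<U>" "finite (T - {c})"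
    using T by auto
  then obtain \<F> where \<F>: "\<F> \<subseteq> \<U>" "finite \<F>" "T - {c} = f ` \<F>"
    by (meson finite_subset_image)
  have "{p \<in> prime_elements L. c \<sqsubseteq> p} \<subseteq> \<Union>\<F>"
  proof
    fix p assume "p \<in> {p \<in> prime_elements L. c \<sqsubseteq> p}"
    then have p: "p \<in> prime_elements L" "c \<sqsubseteq> p" "p \<in> carrier L" "p \<noteq> \<top>"
      by (auto simp: prime_elements_def)
    have "\<not> y \<sqsubseteq> p"
      using p y c join_le_iff[of c y p] top_le_iff[of p] by auto
    then have "\<not> \<Squnion>T \<sqsubseteq> p"
      using T p y le_trans[of y "\<Squnion>T" p] sup_closed[OF subset_trans[OF T(1) sub]] by auto
    then obtain t where t: "t \<in> T" "\<not> t \<sqsubseteq> p"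
      using T sub p Sup_le_iff[of T p] by blast
    then have "t \<in> f ` \<F>"
      using \<F>(3) p(2) by (metis DiffI singletonD)
    then obtain U where U: "U \<in> \<F>" "t = f U"
      by auto
    then have "U = basic_open L t"
      using f \<F> by auto
    then show "p \<in> \<Union>\<F>"
      using t p U by (auto simp: basic_open_def)
  qed
  then show "\<exists>\<F>. finite \<F> \<and> \<F> \<subseteq> \<U> \<and> {p \<in> prime_elements L. c \<sqsubseteq> p} \<subseteq> \<Union>\<F>"
    using \<F> by blast
qed auto

text \<open>The compact set is the complement of \<open>basic_open L c\<close>, where
  \<open>c\<close> separates \<open>x\<close> from \<open>y\<close>: it contains
  \<open>basic_open L x\<close> because \<open>x \<sqinter> c = \<bottom>\<close>, and it is compact
  by \<open>compactin_above\<close>.\<close>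

lemma way_below_imp_compact_between:
  assumes "way_below L x y" "way_below L y \<top>" "x \<in> carrier L" "y \<in> carrier L"
  shows "\<exists>K. compactin (spectrum L) K \<and> basic_open L x \<subseteq> K"
proof -
  obtain c where c: "c \<in> carrier L" "x \<sqinter> c = \<bottom>" "c \<squnion> y = \<top>"
    using way_below_imp_well_inside[OF assms(1,3,4)] .
  have "basic_open L x \<inter> basic_open L c = {}"
    using basic_open_meet[of x c] c assms by (simp add: basic_open_bottom)
  then have "basic_open L x \<subseteq> {p \<in> prime_elements L. c \<sqsubseteq> p}"
    by (auto simp: basic_open_def)
  then show ?thesis
    using compactin_above[OF assms(4,2) c(1,3)] by blast
qed

text \<open>\<open>ex_way_below\<close> is applied twice, starting from the top, which is not below
  a prime. The resulting neighbourhoods of \<open>p\<close> have compact hulls; they yield local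
  compactness and, further on, properness of spectrum maps.\<close>

lemma ex_way_below_way_below_top:
  assumes "p \<in> prime_elements L"
  obtains x y where "x \<in> carrier L" "y \<in> carrier L" "way_below L x y" "way_below L y \<top>"
    "p \<in> basic_open L x"
proof -
  have p: "p \<in> carrier L" "\<not> \<top> \<sqsubseteq> p"
    using assms by (auto simp: prime_elements_def top_le_iff)
  obtain y where y: "y \<in> carrier L" "way_below L y \<top>" "\<not> y \<sqsubseteq> p"
    using ex_way_below[of \<top> p] p by blast
  obtain x where "x \<in> carrier L" "way_below L x y" "\<not> x \<sqsubseteq> p"
    using ex_way_below[of y p] p y by blast
  with y that assms show ?thesis
    by (auto simp: basic_open_def)
qed

lemma locally_compact_spectrum: "locally_compact_space (spectrum L)"
  unfolding locally_compact_space_def topspace_spectrum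
proof
  fix p assume "p \<in> prime_elements L"
  then obtain x y where "x \<in> carrier L" "y \<in> carrier L" "way_below L x y" "way_below L y \<top>"
    "p \<in> basic_open L x"
    using ex_way_below_way_below_top by metis
  then show "\<exists>U K. openin (spectrum L) U \<and> compactin (spectrum L) K \<and> p \<in> U \<and> U \<subseteq> K"
    using way_below_imp_compact_between by (metis openin_basic_open)
qed

lemma spectrum_in_LCHaus: "spectrum L \<in> Obj LCHaus"
  by (simp add: LCHaus_def Hausdorff_spectrum locally_compact_spectrum lepoll_opens_spectrum)

end

section \<open>Criteria for equality in a frame\<close>

context frame
begin

lemma Sup_eqI:
  assumes "S \<subseteq> carrier L" "z \<in> carrier L" "\<And>s. s \<in> S \<Longrightarrow> s \<sqsubseteq> z"
    "\<And>u. \<lbrakk>u \<in> carrier L; \<And>s. s \<in> S \<Longrightarrow> s \<sqsubseteq> u\<rbrakk> \<Longrightarrow> z \<sqsubseteq> u"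
  shows "\<Squnion>S = z"
proof (rule le_antisym)
  show "z \<sqsubseteq> \<Squnion>S"
    using assms(1) by (intro assms(4) sup_upper) auto
qed (use assms in \<open>auto simp: Sup_le_iff\<close>)

lemma meet_eqI:
  assumes "x \<in> carrier L" "y \<in> carrier L" "z \<in> carrier L" "z \<sqsubseteq> x" "z \<sqsubseteq> y"
    "\<And>u. \<lbrakk>u \<in> carrier L; u \<sqsubseteq> x; u \<sqsubseteq> y\<rbrakk> \<Longrightarrow> u \<sqsubseteq> z"
  shows "x \<sqinter> y = z"
  using assms by (intro le_antisym) (auto simp: le_meet_iff meet_left meet_right)

text \<open>Suited to values of right adjoints, which are known through the elements below
  them.\<close>

lemma eq_if_same_lower:
  assumes "x \<in> carrier L" "y \<in> carrier L" "\<And>a. a \<in> carrier L \<Longrightarrow> a \<sqsubseteq> x \<longleftrightarrow> a \<sqsubseteq> y"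
  shows "x = y"
  using assms(3)[of x] assms(3)[of y] assms(1,2) by (intro le_antisym) auto

end

section \<open>Order isomorphisms of frames\<close>

text \<open>Joins, meets and \<open>way_below\<close> are determined by the order, so a bijection
  that preserves and reflects the order is an isomorphism in \<open>ContRegFrm\<close> once it is
  extensional.\<close>

locale order_iso = L: frame L + M: frame M for L :: "'a gorder" and M :: "'b gorder" +
  fixes \<phi> :: "'a \<Rightarrow> 'b"
  assumes bij: "bij_betw \<phi> (carrier L) (carrier M)"
    and le_iff: "\<lbrakk>a \<in> carrier L; b \<in> carrier L\<rbrakk> \<Longrightarrow> \<phi> a \<sqsubseteq>\<^bsub>M\<^esub> \<phi> b \<longleftrightarrow> a \<sqsubseteq>\<^bsub>L\<^esub> b"
begin

lemma maps: "a \<in> carrier L \<Longrightarrow> \<phi> a \<in> carrier M"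
  using bij by (auto simp: bij_betw_def)

lemma surj: "b \<in> carrier M \<Longrightarrow> \<exists>a\<in>carrier L. b = \<phi> a"
  using bij by (auto simp: bij_betw_def)

lemma Sup: "S \<subseteq> carrier L \<Longrightarrow> \<Squnion>\<^bsub>M\<^esub>(\<phi> ` S) = \<phi> (\<Squnion>\<^bsub>L\<^esub>S)"
proof (rule M.Sup_eqI)
  fix u assume S: "S \<subseteq> carrier L" and u: "u \<in> carrier M" "\<And>s. s \<in> \<phi> ` S \<Longrightarrow> s \<sqsubseteq>\<^bsub>M\<^esub> u"
  obtain v where v: "v \<in> carrier L" "u = \<phi> v"
    using surj u by blast
  have "s \<sqsubseteq>\<^bsub>L\<^esub> v" if "s \<in> S" for s
    using that u(2)[of "\<phi> s"] v S le_iff[of s v] by auto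
  then show "\<phi> (\<Squnion>\<^bsub>L\<^esub>S) \<sqsubseteq>\<^bsub>M\<^esub> u"
    using v S le_iff[of "\<Squnion>\<^bsub>L\<^esub>S" v] by (auto simp: L.Sup_le_iff)
qed (auto simp: le_iff subset_iff intro!: maps L.sup_upper)

lemma frame_hom: "\<phi> \<in> extensional (carrier L) \<Longrightarrow> frame_hom L M \<phi>"
  unfolding frame_hom_def
proof (intro conjI ballI allI impI)
  assume "\<phi> \<in> extensional (carrier L)"
  then show "\<phi> \<in> carrier L \<rightarrow>\<^sub>E carrier M"
    using maps by (auto simp: PiE_def)
  obtain t where t: "t \<in> carrier L" "\<top>\<^bsub>M\<^esub> = \<phi> t"
    using surj M.top_closed by blast
  then have "\<phi> t \<sqsubseteq>\<^bsub>M\<^esub> \<phi> \<top>\<^bsub>L\<^esub>"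
    by (simp add: le_iff)
  then show "\<phi> \<top>\<^bsub>L\<^esub> = \<top>\<^bsub>M\<^esub>"
    using t maps[OF L.top_closed] M.top_le_iff by simp
next
  fix a b assume ab: "a \<in> carrier L" "b \<in> carrier L"
  have "\<phi> a \<sqinter>\<^bsub>M\<^esub> \<phi> b = \<phi> (a \<sqinter>\<^bsub>L\<^esub> b)"
  proof (rule M.meet_eqI)
    fix u assume u: "u \<in> carrier M" "u \<sqsubseteq>\<^bsub>M\<^esub> \<phi> a" "u \<sqsubseteq>\<^bsub>M\<^esub> \<phi> b"
    then obtain v where "v \<in> carrier L" "u = \<phi> v"
      using surj by blast
    then show "u \<sqsubseteq>\<^bsub>M\<^esub> \<phi> (a \<sqinter>\<^bsub>L\<^esub> b)"
      using u ab by (simp add: le_iff L.le_meet_iff)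
  qed (use ab in \<open>auto simp: maps le_iff L.meet_left L.meet_right\<close>)
  then show "\<phi> (a \<sqinter>\<^bsub>L\<^esub> b) = \<phi> a \<sqinter>\<^bsub>M\<^esub> \<phi> b" ..
qed (simp add: Sup)

lemma way_below:
  assumes "a \<in> carrier L" "b \<in> carrier L" "way_below L a b"
  shows "way_below M (\<phi> a) (\<phi> b)"
  unfolding way_below_def
proof (intro allI impI)
  fix S assume S: "S \<subseteq> carrier M" "\<phi> b \<sqsubseteq>\<^bsub>M\<^esub> \<Squnion>\<^bsub>M\<^esub>S"
  then obtain S' where S': "S' \<subseteq> carrier L" "S = \<phi> ` S'"
    using bij by (metis bij_betw_imp_surj_on subset_imageE)
  then have "b \<sqsubseteq>\<^bsub>L\<^esub> \<Squnion>\<^bsub>L\<^esub>S'"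
    using S assms by (simp add: Sup le_iff)
  then obtain T where T: "T \<subseteq> S'" "finite T" "T \<subseteq> carrier L" "\<Squnion>\<^bsub>L\<^esub>T \<in> carrier L" "a \<sqsubseteq>\<^bsub>L\<^esub> \<Squnion>\<^bsub>L\<^esub>T"
    using L.way_belowE[OF assms(3) S'(1)] by metis
  then have "\<phi> a \<sqsubseteq>\<^bsub>M\<^esub> \<Squnion>\<^bsub>M\<^esub>(\<phi> ` T)"
    using assms by (simp add: Sup le_iff)
  then show "\<exists>T\<subseteq>S. finite T \<and> \<phi> a \<sqsubseteq>\<^bsub>M\<^esub> \<Squnion>\<^bsub>M\<^esub>T"
    using T S' by (intro exI[of _ "\<phi> ` T"]) auto
qed

lemma proper_frame_hom: "\<phi> \<in> extensional (carrier L) \<Longrightarrow> proper_frame_hom L M \<phi>"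
  using frame_hom way_below by (simp add: proper_frame_hom_def)

text \<open>\<open>restrict\<close> makes the inverse extensional, as arrows of
  \<open>ContRegFrm\<close> have to be.\<close>

lemma inverse: "order_iso M L (restrict (inv_into (carrier L) \<phi>) (carrier M))"
proof
  let ?\<psi> = "restrict (inv_into (carrier L) \<phi>) (carrier M)"
  show "bij_betw ?\<psi> (carrier M) (carrier L)"
    using bij_betw_inv_into[OF bij] by (rule bij_betw_cong[THEN iffD1, rotated]) auto
  fix a b assume "a \<in> carrier M" "b \<in> carrier M"
  then obtain x y where "x \<in> carrier L" "a = \<phi> x" "y \<in> carrier L" "b = \<phi> y"
    using surj by meson
  then show "?\<psi> a \<sqsubseteq>\<^bsub>L\<^esub> ?\<psi> b \<longleftrightarrow> a \<sqsubseteq>\<^bsub>M\<^esub> b"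
    using bij_betw_inv_into_left[OF bij] by (simp add: maps le_iff)
qed

end

lemma order_iso_imp_isomorphism:
  fixes L M :: "'u gorder"
  assumes "order_iso L M \<phi>" "\<phi> \<in> extensional (carrier L)"
  shows "isomorphism ContRegFrm L M \<phi>"
proof -
  interpret order_iso L M \<phi> by fact
  let ?\<psi> = "restrict (inv_into (carrier L) \<phi>) (carrier M)"
  interpret inv: order_iso M L ?\<psi> by (rule inverse)
  have "compose (carrier L) ?\<psi> \<phi> = (\<lambda>x\<in>carrier L. x)"
    using bij_betw_inv_into_left[OF bij] maps by (auto simp: compose_def fun_eq_iff)
  moreover have "compose (carrier M) \<phi> ?\<psi> = (\<lambda>x\<in>carrier M. x)"
    using bij_betw_inv_into_right[OF bij] by (auto simp: compose_def fun_eq_iff)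
  ultimately show ?thesis
    using proper_frame_hom[OF assms(2)] inv.proper_frame_hom
    by (auto simp: isomorphism_def ContRegFrm_def)
qed

section \<open>The frame of open sets\<close>

text \<open>The choice is meaningful only if the open sets embed into the universe.\<close>

definition open_code :: "'u topology \<Rightarrow> 'u set \<Rightarrow> 'u" where
  "open_code X = (SOME e. inj_on e {U. openin X U})"

definition open_decode :: "'u topology \<Rightarrow> 'u \<Rightarrow> 'u set" where
  "open_decode X = inv_into {U. openin X U} (open_code X)"

text \<open>Codes stand in for open sets because the elements of a frame in
  \<open>ContRegFrm\<close> must have type \<open>'u\<close>, whereas open sets have type
  \<open>'u set\<close>.\<close>

definition open_frame :: "'u topology \<Rightarrow> 'u gorder" where
  "open_frame X =
     \<lparr>carrier = open_code X ` {U. openin X U}, eq = (=),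
      le = (\<lambda>a b. open_decode X a \<subseteq> open_decode X b)\<rparr>"

locale small_space =
  fixes X :: "'u topology"
  assumes small: "{U. openin X U} \<lesssim> (UNIV :: 'u set)"
begin

abbreviation "code \<equiv> open_code X"
abbreviation "decode \<equiv> open_decode X"

lemma inj_code: "inj_on code {U. openin X U}"
proof -
  have "\<exists>e :: 'u set \<Rightarrow> 'u. inj_on e {U. openin X U}"
    using small by (auto simp: lepoll_def)
  then show ?thesis
    unfolding open_code_def by (rule someI_ex)
qed

lemma decode_code [simp]: "openin X U \<Longrightarrow> decode (code U) = U"
  unfolding open_decode_def by (rule inv_into_f_f[OF inj_code]) simp

lemma carrier_open_frame: "carrier (open_frame X) = code ` {U. openin X U}"
  by (simp add: open_frame_def)

lemma le_open_frame [simp]: "a \<sqsubseteq>\<^bsub>open_frame X\<^esub> b \<longleftrightarrow> decode a \<subseteq> decode b"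
  by (simp add: open_frame_def)

lemma code_closed [simp]: "openin X U \<Longrightarrow> code U \<in> carrier (open_frame X)"
  by (simp add: carrier_open_frame)

lemma openin_decode [simp]: "a \<in> carrier (open_frame X) \<Longrightarrow> openin X (decode a)"
  by (auto simp: carrier_open_frame)

lemma code_decode [simp]: "a \<in> carrier (open_frame X) \<Longrightarrow> code (decode a) = a"
  by (auto simp: carrier_open_frame)

lemma complete_lattice_open_frame: "complete_lattice (open_frame X)"
proof -
  interpret partial_order "open_frame X"
  proof
    fix x y assume "x \<in> carrier (open_frame X)" "y \<in> carrier (open_frame X)"
      "x \<sqsubseteq>\<^bsub>open_frame X\<^esub> y" "y \<sqsubseteq>\<^bsub>open_frame X\<^esub> x"
    then show "x .=\<^bsub>open_frame X\<^esub> y"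
      by (metis code_decode equalityI le_open_frame open_frame_def eq_object.select_convs(1))
  qed (auto simp: open_frame_def)
  show ?thesis
  proof (rule complete_latticeI)
    fix A assume A: "A \<subseteq> carrier (open_frame X)"
    have U: "openin X (\<Union>(decode ` A))"
      using A by (intro openin_Union) auto
    then have "least (open_frame X) (code (\<Union>(decode ` A))) (Upper (open_frame X) A)"
      using A by (intro least_UpperI) (auto simp: Upper_def)
    then show "\<exists>s. least (open_frame X) s (Upper (open_frame X) A)" ..
    \<comment> \<open>An intersection of open sets need not be open, so the infimum is its interior;
      for empty \<open>A\<close> this is the whole space.\<close>
    let ?I = "X interior_of (topspace X \<inter> \<Inter>(decode ` A))"
    have "greatest (open_frame X) (code ?I) (Lower (open_frame X) A)"
    proof (rule greatest_LowerI)
      fix x assume "x \<in> A"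
      then show "code ?I \<sqsubseteq>\<^bsub>open_frame X\<^esub> x"
        using interior_of_subset[of X "topspace X \<inter> \<Inter>(decode ` A)"] by auto
    next
      fix y assume "y \<in> Lower (open_frame X) A"
      then have y: "y \<in> carrier (open_frame X)" "\<And>x. x \<in> A \<Longrightarrow> decode y \<subseteq> decode x"
        using A by (auto simp: Lower_def)
      then have "decode y \<subseteq> ?I"
        using openin_subset[OF openin_decode[OF y(1)]] by (intro interior_of_maximal) auto
      then show "y \<sqsubseteq>\<^bsub>open_frame X\<^esub> code ?I"
        by simp
    qed (use A in auto)
    then show "\<exists>i. greatest (open_frame X) i (Lower (open_frame X) A)" ..
  qed
qed

sublocale complete_lattice "open_frame X"
  by (rule complete_lattice_open_frame)

lemma decode_Sup:
  assumes "S \<subseteq> carrier (open_frame X)"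
  shows "decode (\<Squnion>\<^bsub>open_frame X\<^esub>S) = \<Union>(decode ` S)"
proof
  have U: "openin X (\<Union>(decode ` S))"
    using assms by (intro openin_Union) auto
  have "\<Squnion>\<^bsub>open_frame X\<^esub>S \<sqsubseteq>\<^bsub>open_frame X\<^esub> code (\<Union>(decode ` S))"
    using assms U by (intro sup_least) auto
  then show "decode (\<Squnion>\<^bsub>open_frame X\<^esub>S) \<subseteq> \<Union>(decode ` S)"
    using U by simp
  have "decode s \<subseteq> decode (\<Squnion>\<^bsub>open_frame X\<^esub>S)" if "s \<in> S" for s
    using sup_upper[OF assms that] by simp
  then show "\<Union>(decode ` S) \<subseteq> decode (\<Squnion>\<^bsub>open_frame X\<^esub>S)"
    by auto
qed

lemma decode_meet:
  assumes a: "a \<in> carrier (open_frame X)" and b: "b \<in> carrier (open_frame X)"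
  shows "decode (a \<sqinter>\<^bsub>open_frame X\<^esub> b) = decode a \<inter> decode b"
proof
  show "decode (a \<sqinter>\<^bsub>open_frame X\<^esub> b) \<subseteq> decode a \<inter> decode b"
    using meet_left[OF a b] meet_right[OF a b] by simp
  have ab: "openin X (decode a \<inter> decode b)"
    using a b by (simp add: openin_Int)
  then have "code (decode a \<inter> decode b) \<sqsubseteq>\<^bsub>open_frame X\<^esub> a \<sqinter>\<^bsub>open_frame X\<^esub> b"
    using a b by (intro meet_le) simp_all
  then show "decode a \<inter> decode b \<subseteq> decode (a \<sqinter>\<^bsub>open_frame X\<^esub> b)"
    using ab by simp
qed

text \<open>Used to turn equations between codes into equations between open sets.\<close>

lemma decode_inject:
  "\<lbrakk>a \<in> carrier (open_frame X); b \<in> carrier (open_frame X)\<rbrakk> \<Longrightarrow> decode a = decode b \<longleftrightarrow> a = b"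
  by (metis code_decode)

lemma decode_top: "decode \<top>\<^bsub>open_frame X\<^esub> = topspace X"
  using top_higher[OF code_closed[OF openin_topspace]] openin_subset[OF openin_decode[OF top_closed]]
  by auto

lemma decode_bottom: "decode \<bottom>\<^bsub>open_frame X\<^esub> = {}"
  using bottom_lower[OF code_closed[OF openin_empty]] by simp

lemma decode_join:
  "\<lbrakk>a \<in> carrier (open_frame X); b \<in> carrier (open_frame X)\<rbrakk>
    \<Longrightarrow> decode (a \<squnion>\<^bsub>open_frame X\<^esub> b) = decode a \<union> decode b"
  by (simp add: join_def decode_Sup)

sublocale frame "open_frame X"
proof
  fix a S assume a: "a \<in> carrier (open_frame X)" and S: "S \<subseteq> carrier (open_frame X)"
  have S': "{a \<sqinter>\<^bsub>open_frame X\<^esub> s |s. s \<in> S} \<subseteq> carrier (open_frame X)"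
    using a S by auto
  have "decode (a \<sqinter>\<^bsub>open_frame X\<^esub> \<Squnion>\<^bsub>open_frame X\<^esub>S) = (\<Union>s\<in>S. decode a \<inter> decode s)"
    using a S by (simp add: decode_meet decode_Sup)
  also have "\<dots> = (\<Union>s\<in>S. decode (a \<sqinter>\<^bsub>open_frame X\<^esub> s))"
    using a S by (intro SUP_cong) (auto simp: decode_meet)
  also have "\<dots> = decode (\<Squnion>\<^bsub>open_frame X\<^esub>{a \<sqinter>\<^bsub>open_frame X\<^esub> s |s. s \<in> S})"
    unfolding decode_Sup[OF S'] by auto
  finally show "a \<sqinter>\<^bsub>open_frame X\<^esub> \<Squnion>\<^bsub>open_frame X\<^esub>S =
      \<Squnion>\<^bsub>open_frame X\<^esub>{a \<sqinter>\<^bsub>open_frame X\<^esub> s |s. s \<in> S}"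
    using a S S' by (simp add: decode_inject)
qed

text \<open>A family of open sets covering \<open>decode b\<close> covers \<open>K\<close>; a finite
  subcover of \<open>K\<close> covers \<open>decode a\<close>.\<close>

lemma way_below_if_compact_between:
  assumes "a \<in> carrier (open_frame X)" "b \<in> carrier (open_frame X)"
    and K: "compactin X K" "decode a \<subseteq> K" "K \<subseteq> decode b"
  shows "way_below (open_frame X) a b"
  unfolding way_below_def
proof (intro allI impI)
  fix S assume S: "S \<subseteq> carrier (open_frame X)" "b \<sqsubseteq>\<^bsub>open_frame X\<^esub> \<Squnion>\<^bsub>open_frame X\<^esub>S"
  then have "K \<subseteq> \<Union>(decode ` S)"
    using K(3) by (simp add: decode_Sup)
  moreover have "\<And>U. U \<in> decode ` S \<Longrightarrow> openin X U"
    using S by auto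
  ultimately obtain \<F> where "finite \<F>" "\<F> \<subseteq> decode ` S" "K \<subseteq> \<Union>\<F>"
    using K(1) unfolding compactin_def by meson
  then obtain T where T: "T \<subseteq> S" "finite T" "K \<subseteq> \<Union>(decode ` T)"
    by (metis finite_subset_image)
  then have "a \<sqsubseteq>\<^bsub>open_frame X\<^esub> \<Squnion>\<^bsub>open_frame X\<^esub>T"
    using K(2) S(1) by (subst le_open_frame, subst decode_Sup) auto
  then show "\<exists>T\<subseteq>S. finite T \<and> a \<sqsubseteq>\<^bsub>open_frame X\<^esub> \<Squnion>\<^bsub>open_frame X\<^esub>T"
    using T by blast
qed

end

section \<open>The frame of opens of a locally compact Hausdorff space\<close>

locale lchaus_space = small_space +
  assumes locally_compact: "locally_compact_space X" and Hausdorff: "Hausdorff_space X"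

lemma LCHaus_Obj_iff: "X \<in> Obj LCHaus \<longleftrightarrow> lchaus_space X"
  by (auto simp: LCHaus_def lchaus_space_def lchaus_space_axioms_def small_space_def)

context lchaus_space
begin

text \<open>In a Hausdorff space, local compactness provides a base of compact neighbourhoods at
  every point.\<close>

lemma compact_neighbourhood:
  assumes "openin X U" "x \<in> U"
  obtains V K where "openin X V" "compactin X K" "x \<in> V" "V \<subseteq> K" "K \<subseteq> U"
  using locally_compact Hausdorff assms
  by (metis locally_compact_space_neighbourhood_base neighbourhood_base_of)

text \<open>For the forward direction, \<open>\<W>\<close> collects the open sets with a compact
  hull inside \<open>decode b\<close>. They cover \<open>decode b\<close> by
  \<open>compact_neighbourhood\<close>, so finitely many cover \<open>decode a\<close>, and the
  union of their hulls is the required compact set.\<close>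

lemma way_below_iff_compact_between:
  assumes a: "a \<in> carrier (open_frame X)" and b: "b \<in> carrier (open_frame X)"
  shows "way_below (open_frame X) a b \<longleftrightarrow> (\<exists>K. compactin X K \<and> decode a \<subseteq> K \<and> K \<subseteq> decode b)"
proof
  assume wb: "way_below (open_frame X) a b"
  define \<W> where "\<W> = {c \<in> carrier (open_frame X). \<exists>K. compactin X K \<and> decode c \<subseteq> K \<and> K \<subseteq> decode b}"
  have \<W>: "\<W> \<subseteq> carrier (open_frame X)"
    by (auto simp: \<W>_def)
  have "decode b \<subseteq> \<Union>(decode ` \<W>)"
  proof
    fix x assume "x \<in> decode b"
    then obtain V K where "openin X V" "compactin X K" "x \<in> V" "V \<subseteq> K" "K \<subseteq> decode b"
      using compact_neighbourhood b openin_decode by metis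
    then show "x \<in> \<Union>(decode ` \<W>)"
      by (intro UN_I[of "code V"]) (auto simp: \<W>_def)
  qed
  then have "b \<sqsubseteq>\<^bsub>open_frame X\<^esub> \<Squnion>\<^bsub>open_frame X\<^esub>\<W>"
    by (simp add: decode_Sup[OF \<W>])
  then obtain T where T: "T \<subseteq> \<W>" "finite T" "T \<subseteq> carrier (open_frame X)"
    "a \<sqsubseteq>\<^bsub>open_frame X\<^esub> \<Squnion>\<^bsub>open_frame X\<^esub>T"
    using way_belowE[OF wb \<W>] by metis
  have "\<forall>t\<in>T. \<exists>K. compactin X K \<and> decode t \<subseteq> K \<and> K \<subseteq> decode b"
    using T by (auto simp: \<W>_def)
  then obtain K where K: "\<And>t. t \<in> T \<Longrightarrow> compactin X (K t) \<and> decode t \<subseteq> K t \<and> K t \<subseteq> decode b"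
    by metis
  have "compactin X (\<Union>(K ` T))"
    using T(2) K by (intro compactin_Union) auto
  moreover have "decode a \<subseteq> \<Union>(K ` T)"
    using T(4) K by (fastforce simp: decode_Sup[OF T(3)])
  moreover have "\<Union>(K ` T) \<subseteq> decode b"
    using K by auto
  ultimately show "\<exists>K. compactin X K \<and> decode a \<subseteq> K \<and> K \<subseteq> decode b"
    by blast
qed (use way_below_if_compact_between[OF a b] in blast)

text \<open>Both joins are computed pointwise. Around \<open>x\<close> in \<open>decode a\<close>
  there are an open \<open>V\<close> and a compact \<open>K\<close> with \<open>V\<close> inside
  \<open>K\<close> inside \<open>decode a\<close>; then \<open>V\<close> is way below
  \<open>a\<close> and also well inside \<open>a\<close>.\<close>

sublocale continuous_regular_frame "open_frame X"
proof
  fix a assume a: "a \<in> carrier (open_frame X)"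
  show "a = \<Squnion>\<^bsub>open_frame X\<^esub>{x \<in> carrier (open_frame X). way_below (open_frame X) x a}"
  proof (rule Sup_eqI[symmetric])
    fix u assume u: "u \<in> carrier (open_frame X)"
      "\<And>s. s \<in> {x \<in> carrier (open_frame X). way_below (open_frame X) x a} \<Longrightarrow> s \<sqsubseteq>\<^bsub>open_frame X\<^esub> u"
    have "x \<in> decode u" if x: "x \<in> decode a" for x
    proof -
      obtain V K where V: "openin X V" "compactin X K" "x \<in> V" "V \<subseteq> K" "K \<subseteq> decode a"
        using compact_neighbourhood[OF openin_decode[OF a] x] .
      then have "way_below (open_frame X) (code V) a"
        using a by (intro way_below_if_compact_between[of _ _ K]) auto
      then show ?thesis
        using u(2)[of "code V"] V by auto
    qed
    then show "a \<sqsubseteq>\<^bsub>open_frame X\<^esub> u"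
      by auto
  qed (use a way_below_imp_le in auto)
  let ?B = "{b \<in> carrier (open_frame X).
    pseudocomplement (open_frame X) b \<squnion>\<^bsub>open_frame X\<^esub> a = \<top>\<^bsub>open_frame X\<^esub>}"
  show "a = \<Squnion>\<^bsub>open_frame X\<^esub>?B"
  proof (rule Sup_eqI[symmetric])
    fix b assume "b \<in> ?B"
    then obtain c where c: "b \<in> carrier (open_frame X)" "c \<in> carrier (open_frame X)"
      "b \<sqinter>\<^bsub>open_frame X\<^esub> c = \<bottom>\<^bsub>open_frame X\<^esub>" "c \<squnion>\<^bsub>open_frame X\<^esub> a = \<top>\<^bsub>open_frame X\<^esub>"
      using a by (auto simp: pseudocomplement_join_top_iff)
    then have "decode b \<inter> decode c = {}" "decode c \<union> decode a = topspace X"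
      using decode_meet[of b c] decode_join[of c a] a decode_bottom decode_top by auto
    then show "b \<sqsubseteq>\<^bsub>open_frame X\<^esub> a"
      using openin_subset[OF openin_decode[OF c(1)]] by auto
  next
    fix u assume u: "u \<in> carrier (open_frame X)" "\<And>s. s \<in> ?B \<Longrightarrow> s \<sqsubseteq>\<^bsub>open_frame X\<^esub> u"
    have "x \<in> decode u" if x: "x \<in> decode a" for x
    proof -
      obtain V K where V: "openin X V" "compactin X K" "x \<in> V" "V \<subseteq> K" "K \<subseteq> decode a"
        using compact_neighbourhood[OF openin_decode[OF a] x] .
      \<comment> \<open>The compact set \<open>K\<close> is closed in a Hausdorff space; its open
        complement misses \<open>V\<close> and covers the space together with
        \<open>decode a\<close>.\<close>
      define c where "c = code (topspace X - K)"
      have op: "openin X (topspace X - K)"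
        using compactin_imp_closedin[OF Hausdorff V(2)] by (simp add: closedin_def)
      then have c: "c \<in> carrier (open_frame X)" "decode c = topspace X - K"
        by (auto simp: c_def)
      have "code V \<sqinter>\<^bsub>open_frame X\<^esub> c = \<bottom>\<^bsub>open_frame X\<^esub>"
        using V c by (subst decode_inject[symmetric]) (auto simp: decode_meet decode_bottom)
      moreover have "c \<squnion>\<^bsub>open_frame X\<^esub> a = \<top>\<^bsub>open_frame X\<^esub>"
        using V c a openin_subset[OF openin_decode[OF a]]
        by (subst decode_inject[symmetric]) (auto simp: decode_join decode_top)
      ultimately have "code V \<in> ?B"
        using V a c by (auto simp: pseudocomplement_join_top_iff)
      then show ?thesis
        using u(2)[of "code V"] V by auto
    qed
    then show "a \<sqsubseteq>\<^bsub>open_frame X\<^esub> u"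
      by auto
  qed (use a in auto)
qed

end

section \<open>The two functors\<close>

definition spectrum_map :: "'a gorder \<Rightarrow> 'b gorder \<Rightarrow> ('a \<Rightarrow> 'b) \<Rightarrow> 'b \<Rightarrow> 'a" where
  "spectrum_map L M h =
     restrict (\<lambda>q. \<Squnion>\<^bsub>L\<^esub>{a \<in> carrier L. h a \<sqsubseteq>\<^bsub>M\<^esub> q}) (prime_elements M)"

locale frame_homomorphism = L: frame L + M: frame M for L :: "'a gorder" and M :: "'b gorder" +
  fixes h :: "'a \<Rightarrow> 'b"
  assumes frame_hom: "frame_hom L M h"
begin

lemma closed: "a \<in> carrier L \<Longrightarrow> h a \<in> carrier M"
  and hom_top: "h \<top>\<^bsub>L\<^esub> = \<top>\<^bsub>M\<^esub>"
  and hom_meet: "\<lbrakk>a \<in> carrier L; b \<in> carrier L\<rbrakk> \<Longrightarrow> h (a \<sqinter>\<^bsub>L\<^esub> b) = h a \<sqinter>\<^bsub>M\<^esub> h b"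
  and hom_Sup: "S \<subseteq> carrier L \<Longrightarrow> h (\<Squnion>\<^bsub>L\<^esub>S) = \<Squnion>\<^bsub>M\<^esub>(h ` S)"
  using frame_hom unfolding frame_hom_def by (auto simp: PiE_iff)

lemma mono:
  assumes "a \<in> carrier L" "b \<in> carrier L" "a \<sqsubseteq>\<^bsub>L\<^esub> b"
  shows "h a \<sqsubseteq>\<^bsub>M\<^esub> h b"
proof -
  have "a \<sqinter>\<^bsub>L\<^esub> b = a"
    using assms by (intro L.meet_eqI) auto
  then show ?thesis
    using hom_meet[OF assms(1,2)] M.meet_right[OF closed closed, OF assms(1,2)] by simp
qed

lemma spectrum_map_closed:
  "q \<in> prime_elements M \<Longrightarrow> spectrum_map L M h q \<in> carrier L"
  by (auto simp: spectrum_map_def)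

text \<open>This is the adjunction: \<open>spectrum_map\<close> is the right adjoint of
  \<open>h\<close>, restricted to primes. Since \<open>h\<close> preserves the defining join, that
  join itself belongs to the set \<open>?A\<close>.\<close>

lemma le_spectrum_map_iff:
  assumes q: "q \<in> prime_elements M" and a: "a \<in> carrier L"
  shows "a \<sqsubseteq>\<^bsub>L\<^esub> spectrum_map L M h q \<longleftrightarrow> h a \<sqsubseteq>\<^bsub>M\<^esub> q"
proof -
  let ?A = "{a \<in> carrier L. h a \<sqsubseteq>\<^bsub>M\<^esub> q}"
  have qM: "q \<in> carrier M"
    using q by (rule M.prime_closed)
  have eq: "spectrum_map L M h q = \<Squnion>\<^bsub>L\<^esub>?A"
    using q by (simp add: spectrum_map_def)
  have "h (\<Squnion>\<^bsub>L\<^esub>?A) \<sqsubseteq>\<^bsub>M\<^esub> q"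
    using qM closed by (subst hom_Sup) (auto simp: M.Sup_le_iff image_subset_iff)
  then have "h a \<sqsubseteq>\<^bsub>M\<^esub> q" if "a \<sqsubseteq>\<^bsub>L\<^esub> \<Squnion>\<^bsub>L\<^esub>?A"
    using M.le_trans[OF mono[OF a _ that]] a qM closed by simp
  moreover have "a \<sqsubseteq>\<^bsub>L\<^esub> \<Squnion>\<^bsub>L\<^esub>?A" if "h a \<sqsubseteq>\<^bsub>M\<^esub> q"
    using that a by (intro L.sup_upper) auto
  ultimately show ?thesis
    unfolding eq by blast
qed

text \<open>The adjunction translates primality of the image into primality of \<open>q\<close> for
  \<open>h a\<close> and \<open>h b\<close>.\<close>

lemma spectrum_map_prime:
  assumes q: "q \<in> prime_elements M"
  shows "spectrum_map L M h q \<in> prime_elements L"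
  unfolding prime_elements_def mem_Collect_eq
proof (intro conjI ballI impI)
  have "\<not> \<top>\<^bsub>L\<^esub> \<sqsubseteq>\<^bsub>L\<^esub> spectrum_map L M h q"
    using q M.top_le_iff by (simp add: le_spectrum_map_iff hom_top prime_elements_def)
  then show "spectrum_map L M h q \<noteq> \<top>\<^bsub>L\<^esub>"
    by auto
  fix a b assume "a \<in> carrier L" "b \<in> carrier L" "a \<sqinter>\<^bsub>L\<^esub> b \<sqsubseteq>\<^bsub>L\<^esub> spectrum_map L M h q"
  then show "a \<sqsubseteq>\<^bsub>L\<^esub> spectrum_map L M h q \<or> b \<sqsubseteq>\<^bsub>L\<^esub> spectrum_map L M h q"
    using q closed by (simp add: le_spectrum_map_iff hom_meet) (simp add: prime_elements_def)
qed (use spectrum_map_closed[OF q] in simp)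

lemma spectrum_map_in_basic_open_iff:
  assumes "q \<in> prime_elements M" "a \<in> carrier L"
  shows "spectrum_map L M h q \<in> basic_open L a \<longleftrightarrow> q \<in> basic_open M (h a)"
  using assms by (simp add: basic_open_def spectrum_map_prime le_spectrum_map_iff)

text \<open>The preimage of \<open>basic_open L a\<close> is \<open>basic_open M (h a)\<close>, and
  all open sets of a spectrum are basic.\<close>

lemma continuous_spectrum_map:
  "continuous_map (spectrum M) (spectrum L) (spectrum_map L M h)"
  unfolding continuous_map_def L.topspace_spectrum M.topspace_spectrum
proof (intro conjI allI impI)
  fix U assume "openin (spectrum L) U"
  then obtain a where a: "a \<in> carrier L" "U = basic_open L a"
    by (auto simp: L.openin_spectrum)
  then have "{q \<in> prime_elements M. spectrum_map L M h q \<in> U} = basic_open M (h a)"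
    using spectrum_map_in_basic_open_iff by (auto simp: basic_open_def)
  then show "openin (spectrum M) {q \<in> prime_elements M. spectrum_map L M h q \<in> U}"
    using a closed by simp
qed (use spectrum_map_prime in auto)

end

text \<open>\<open>K\<close> is the intersection of the open complements of the points outside
  \<open>K\<close>; for \<open>K = topspace X\<close> the family is empty.\<close>

lemma saturatedin_if_t1_space:
  assumes "t1_space X" "K \<subseteq> topspace X"
  shows "saturatedin X K"
  unfolding saturatedin_def
proof (intro exI conjI ballI)
  let ?\<U> = "(\<lambda>x. topspace X - {x}) ` (topspace X - K)"
  fix U assume "U \<in> ?\<U>"
  then show "openin X U"
    using assms by (auto simp: t1_space_openin_delete_alt)
qed (use assms in auto)

lemma Hausdorff_proper_continuous_map_iff:
  assumes "Hausdorff_space Y"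
  shows "proper_continuous_map X Y f \<longleftrightarrow>
    continuous_map X Y f \<and> (\<forall>K. compactin Y K \<longrightarrow> compactin X {x \<in> topspace X. f x \<in> K})"
  using saturatedin_if_t1_space[OF Hausdorff_imp_t1_space[OF assms]] compactin_subset_topspace
  unfolding proper_continuous_map_def by metis

locale proper_homomorphism =
  L: continuous_regular_frame L + M: continuous_regular_frame M + frame_homomorphism L M h
  for L :: "'a gorder" and M :: "'b gorder" and h +
  assumes way_below: "\<lbrakk>a \<in> carrier L; b \<in> carrier L; way_below L a b\<rbrakk> \<Longrightarrow> way_below M (h a) (h b)"
begin

text \<open>The preimage of a compact set is closed, so it suffices to place it inside a compact
  set. Finitely many sets \<open>basic_open L x\<close> with \<open>x\<close> in \<open>R\<close>
  cover \<open>K\<close>; each preimage \<open>basic_open M (h x)\<close> has a compact hull,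
  because \<open>h\<close> preserves \<open>way_below\<close> and the top.\<close>

lemma proper_spectrum_map:
  "proper_continuous_map (spectrum M) (spectrum L) (spectrum_map L M h)"
  unfolding Hausdorff_proper_continuous_map_iff[OF L.Hausdorff_spectrum]
proof (intro conjI allI impI continuous_spectrum_map)
  fix K assume K: "compactin (spectrum L) K"
  let ?P = "{q \<in> topspace (spectrum M). spectrum_map L M h q \<in> K}"
  \<comment> \<open>\<open>R\<close> consists of the elements to which
    \<open>way_below_imp_compact_between\<close> applies.\<close>
  define R where "R = {x \<in> carrier L. \<exists>y\<in>carrier L. way_below L x y \<and> way_below L y \<top>\<^bsub>L\<^esub>}"
  have "K \<subseteq> \<Union>(basic_open L ` R)"
  proof
    fix p assume "p \<in> K"
    then have "p \<in> prime_elements L"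
      using compactin_subset_topspace[OF K] by auto
    then obtain x y where "x \<in> carrier L" "y \<in> carrier L" "way_below L x y"
        "way_below L y \<top>\<^bsub>L\<^esub>" "p \<in> basic_open L x"
      by (rule L.ex_way_below_way_below_top)
    then show "p \<in> \<Union>(basic_open L ` R)"
      by (intro UN_I[of x]) (auto simp: R_def)
  qed
  moreover have "\<And>U. U \<in> basic_open L ` R \<Longrightarrow> openin (spectrum L) U"
    by (auto simp: R_def)
  ultimately obtain \<F> where "finite \<F>" "\<F> \<subseteq> basic_open L ` R" "K \<subseteq> \<Union>\<F>"
    using K unfolding compactin_def by meson
  then obtain T where T: "T \<subseteq> R" "finite T" "K \<subseteq> \<Union>(basic_open L ` T)"
    by (metis finite_subset_image)
  have "\<exists>C. compactin (spectrum M) C \<and> basic_open M (h x) \<subseteq> C" if "x \<in> R" for x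
  proof -
    from that obtain y where y: "x \<in> carrier L" "y \<in> carrier L" "way_below L x y"
        "way_below L y \<top>\<^bsub>L\<^esub>"
      by (auto simp: R_def)
    have "way_below M (h x) (h y)" "way_below M (h y) \<top>\<^bsub>M\<^esub>"
      using way_below[OF y(1-3)] way_below[OF y(2) L.top_closed y(4)] by (simp_all add: hom_top)
    then show ?thesis
      using M.way_below_imp_compact_between y closed by blast
  qed
  then obtain C where C: "\<And>x. x \<in> R \<Longrightarrow> compactin (spectrum M) (C x) \<and> basic_open M (h x) \<subseteq> C x"
    by metis
  have "compactin (spectrum M) (\<Union>(C ` T))"
    using T C by (intro compactin_Union) auto
  moreover have "?P \<subseteq> \<Union>(C ` T)"
  proof
    fix q assume q: "q \<in> ?P"
    then obtain x where x: "x \<in> T" "spectrum_map L M h q \<in> basic_open L x"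
      using T by auto
    then have "q \<in> basic_open M (h x)"
      using spectrum_map_in_basic_open_iff[of q x] q T by (auto simp: R_def)
    then show "q \<in> \<Union>(C ` T)"
      using C[of x] x T by auto
  qed
  \<comment> \<open>\<open>K\<close> is closed because \<open>spectrum L\<close> is
    Hausdorff.\<close>
  moreover have "closedin (spectrum M) ?P"
    using continuous_spectrum_map compactin_imp_closedin[OF L.Hausdorff_spectrum K]
    by (rule closedin_continuous_map_preimage)
  ultimately show "compactin (spectrum M) ?P"
    by (rule closed_compactin)
qed

end

lemma ContRegFrm_Hom_iff:
  assumes "L \<in> Obj ContRegFrm" "M \<in> Obj ContRegFrm"
  shows "h \<in> Hom ContRegFrm L M \<longleftrightarrow> proper_homomorphism L M h \<and> h \<in> extensional (carrier L)"
proof -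
  interpret L: continuous_regular_frame L using assms by (simp add: ContRegFrm_Obj_iff)
  interpret M: continuous_regular_frame M using assms by (simp add: ContRegFrm_Obj_iff)
  show ?thesis
    by (auto simp: ContRegFrm_def proper_frame_hom_def proper_homomorphism_def frame_hom_def PiE_def
        frame_homomorphism_def frame_homomorphism_axioms_def proper_homomorphism_axioms_def
        L.continuous_regular_frame_axioms M.continuous_regular_frame_axioms
        L.frame_axioms M.frame_axioms)
qed

section \<open>Category laws and functoriality of the spectrum\<close>

lemma category_ContRegFrm: "category (ContRegFrm :: ('u gorder, 'u \<Rightarrow> 'u) precategory)"
proof
  fix L M N :: "'u gorder" and g h
  assume LMN: "L \<in> Obj ContRegFrm" "M \<in> Obj ContRegFrm" "N \<in> Obj ContRegFrm"
    and h: "h \<in> Hom ContRegFrm L M" and g: "g \<in> Hom ContRegFrm M N"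
  interpret h: proper_homomorphism L M h using h LMN by (simp add: ContRegFrm_Hom_iff)
  interpret g: proper_homomorphism M N g using g LMN by (simp add: ContRegFrm_Hom_iff)
  have "frame_hom L N (compose (carrier L) g h)"
    unfolding frame_hom_def
  proof (intro conjI ballI allI impI)
    fix S assume S: "S \<subseteq> carrier L"
    have "compose (carrier L) g h ` S = g ` h ` S"
      unfolding image_image using S by (intro image_cong) (auto simp: compose_def)
    moreover have "g (\<Squnion>\<^bsub>M\<^esub>(h ` S)) = \<Squnion>\<^bsub>N\<^esub>(g ` h ` S)"
      using S h.closed by (intro g.hom_Sup) auto
    ultimately show "compose (carrier L) g h (\<Squnion>\<^bsub>L\<^esub>S) = \<Squnion>\<^bsub>N\<^esub>(compose (carrier L) g h ` S)"
      using S by (simp add: compose_eq h.hom_Sup)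
  qed (auto simp: compose_def h.hom_top g.hom_top h.hom_meet g.hom_meet h.closed g.closed)
  then show "Comp ContRegFrm L M N g h \<in> Hom ContRegFrm L N"
    by (auto simp: ContRegFrm_def proper_frame_hom_def compose_def
        intro!: g.way_below h.way_below h.closed)
next
  fix L :: "'u gorder" assume "L \<in> Obj ContRegFrm"
  then interpret continuous_regular_frame L by (simp add: ContRegFrm_Obj_iff)
  have "restrict (\<lambda>x. x) (carrier L) ` S = S" if "S \<subseteq> carrier L" for S
    using that by (auto simp: image_iff subset_iff)
  then show "Id ContRegFrm L \<in> Hom ContRegFrm L L"
    by (simp add: ContRegFrm_def proper_frame_hom_def frame_hom_def)
qed (auto simp: ContRegFrm_def proper_frame_hom_def frame_hom_def compose_def fun_eq_iff PiE_iff
    extensional_def)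

lemma category_LCHaus: "category (LCHaus :: ('u topology, 'u \<Rightarrow> 'u) precategory)"
proof
  fix X Y Z :: "'u topology" and f g
  assume XYZ: "X \<in> Obj LCHaus" "Y \<in> Obj LCHaus" "Z \<in> Obj LCHaus"
    and f: "f \<in> Hom LCHaus X Y" and g: "g \<in> Hom LCHaus Y Z"
  have haus: "Hausdorff_space Y" "Hausdorff_space Z"
    using XYZ by (auto simp: LCHaus_def)
  have f': "continuous_map X Y f" "\<And>K. compactin Y K \<Longrightarrow> compactin X {x \<in> topspace X. f x \<in> K}"
    and g': "continuous_map Y Z g" "\<And>K. compactin Z K \<Longrightarrow> compactin Y {x \<in> topspace Y. g x \<in> K}"
    using f g haus by (auto simp: LCHaus_def Hausdorff_proper_continuous_map_iff)
  have "continuous_map X Z (compose (topspace X) g f)"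
    by (rule continuous_map_eq[OF continuous_map_compose[OF f'(1) g'(1)]]) (simp add: compose_def)
  moreover have "compactin X {x \<in> topspace X. compose (topspace X) g f x \<in> K}" if "compactin Z K" for K
  proof -
    have "{x \<in> topspace X. compose (topspace X) g f x \<in> K} =
        {x \<in> topspace X. f x \<in> {y \<in> topspace Y. g y \<in> K}}"
      using continuous_map_funspace[OF f'(1)] by (auto simp: compose_def)
    then show ?thesis
      using f'(2)[OF g'(2)[OF that]] by simp
  qed
  ultimately show "Comp LCHaus X Y Z g f \<in> Hom LCHaus X Z"
    using haus by (simp add: LCHaus_def Hausdorff_proper_continuous_map_iff)
next
  fix X :: "'u topology" assume X: "X \<in> Obj LCHaus"
  have "continuous_map X X (restrict (\<lambda>x. x) (topspace X))"
    by (rule continuous_map_eq[OF continuous_map_id]) simp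
  moreover have "{x \<in> topspace X. restrict (\<lambda>x. x) (topspace X) x \<in> K} = K" if "compactin X K" for K
    using compactin_subset_topspace[OF that] by auto
  ultimately show "Id LCHaus X \<in> Hom LCHaus X X"
    using X by (simp add: LCHaus_def Hausdorff_proper_continuous_map_iff)
qed (auto simp: LCHaus_def proper_continuous_map_def compose_def fun_eq_iff extensional_def
    continuous_map_def Pi_iff)

lemma category_opposite: "category C \<Longrightarrow> category (opposite C)"
  unfolding category_def opposite_def by simp

lemma spectrum_map_id:
  assumes "frame L" "q \<in> prime_elements L"
  shows "spectrum_map L L (\<lambda>x\<in>carrier L. x) q = q"
proof -
  interpret frame L by fact
  have "restrict (\<lambda>x. x) (carrier L) ` S = S" if "S \<subseteq> carrier L" for S
    using that by (auto simp: image_iff subset_iff)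
  then interpret frame_homomorphism L L "\<lambda>x\<in>carrier L. x"
    by unfold_locales (simp add: frame_hom_def)
  show ?thesis
    using assms(2) by (intro eq_if_same_lower) (auto simp: le_spectrum_map_iff spectrum_map_closed prime_closed)
qed

lemma is_functor_spectrum:
  "is_functor (ContRegFrm :: ('u gorder, 'u \<Rightarrow> 'u) precategory) (opposite LCHaus)
     \<lparr>obj_map = spectrum, arr_map = spectrum_map\<rparr>"
  unfolding is_functor_def functor_data.simps
proof (intro conjI ballI)
  fix L :: "'u gorder" assume "L \<in> Obj ContRegFrm"
  then interpret continuous_regular_frame L by (simp add: ContRegFrm_Obj_iff)
  show "spectrum L \<in> Obj (opposite LCHaus)"
    using spectrum_in_LCHaus by (simp add: opposite_def)
  show "spectrum_map L L (Id ContRegFrm L) = Id (opposite LCHaus) (spectrum L)"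
    using spectrum_map_id[OF frame_axioms]
    by (auto simp: fun_eq_iff opposite_def LCHaus_def ContRegFrm_def) (simp add: spectrum_map_def)
next
  fix L M :: "'u gorder" and h
  assume LM: "L \<in> Obj ContRegFrm" "M \<in> Obj ContRegFrm" and h: "h \<in> Hom ContRegFrm L M"
  then interpret proper_homomorphism L M h by (simp add: ContRegFrm_Hom_iff)
  show "spectrum_map L M h \<in> Hom (opposite LCHaus) (spectrum L) (spectrum M)"
    using proper_spectrum_map by (simp add: opposite_def LCHaus_def) (simp add: spectrum_map_def)
next
  fix L M N :: "'u gorder" and g h
  assume LMN: "L \<in> Obj ContRegFrm" "M \<in> Obj ContRegFrm" "N \<in> Obj ContRegFrm"
    and h: "h \<in> Hom ContRegFrm L M" and g: "g \<in> Hom ContRegFrm M N"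
  interpret h: proper_homomorphism L M h using h LMN by (simp add: ContRegFrm_Hom_iff)
  interpret g: proper_homomorphism M N g using g LMN by (simp add: ContRegFrm_Hom_iff)
  have "Comp ContRegFrm L M N g h \<in> Hom ContRegFrm L N"
    using category.Comp_in_Hom[OF category_ContRegFrm] LMN g h by blast
  then have "compose (carrier L) g h \<in> Hom ContRegFrm L N"
    by (simp add: ContRegFrm_def)
  then interpret gh: proper_homomorphism L N "compose (carrier L) g h"
    using LMN by (simp add: ContRegFrm_Hom_iff)
  \<comment> \<open>Right adjoints compose in reverse order: an element \<open>a\<close> lies below
    either side iff \<open>g (h a)\<close> lies below \<open>q\<close>.\<close>
  have "spectrum_map L N (compose (carrier L) g h) q = spectrum_map L M h (spectrum_map M N g q)"
    if q: "q \<in> prime_elements N" for q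
  proof (rule h.L.eq_if_same_lower)
    fix a assume "a \<in> carrier L"
    then show "a \<sqsubseteq>\<^bsub>L\<^esub> spectrum_map L N (compose (carrier L) g h) q \<longleftrightarrow>
        a \<sqsubseteq>\<^bsub>L\<^esub> spectrum_map L M h (spectrum_map M N g q)"
      using q by (simp add: gh.le_spectrum_map_iff h.le_spectrum_map_iff g.le_spectrum_map_iff
          g.spectrum_map_prime h.closed compose_eq)
  qed (use q in \<open>simp_all add: gh.spectrum_map_closed h.spectrum_map_closed g.spectrum_map_prime\<close>)
  then show "spectrum_map L N (Comp ContRegFrm L M N g h) =
      Comp (opposite LCHaus) (spectrum L) (spectrum M) (spectrum N)
        (spectrum_map M N g) (spectrum_map L M h)"
    by (auto simp: fun_eq_iff opposite_def LCHaus_def ContRegFrm_def compose_def)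
      (auto simp: spectrum_map_def)
qed

section \<open>Proper maps induce preimage homomorphisms of frames of opens\<close>

definition open_frame_map :: "'u topology \<Rightarrow> 'u topology \<Rightarrow> ('u \<Rightarrow> 'u) \<Rightarrow> 'u \<Rightarrow> 'u" where
  "open_frame_map X Y f =
     restrict (\<lambda>b. open_code X {x \<in> topspace X. f x \<in> open_decode Y b}) (carrier (open_frame Y))"

locale proper_space_map = X: lchaus_space X + Y: lchaus_space Y for X Y :: "'u topology" +
  fixes f
  assumes proper: "proper_continuous_map X Y f"
begin

lemma continuous: "continuous_map X Y f"
  using proper by (simp add: proper_continuous_map_def)

lemma openin_preimage:
  "b \<in> carrier (open_frame Y) \<Longrightarrow> openin X {x \<in> topspace X. f x \<in> Y.decode b}"
  using continuous Y.openin_decode by (rule openin_continuous_map_preimage)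

lemma open_frame_map_closed:
  "b \<in> carrier (open_frame Y) \<Longrightarrow> open_frame_map X Y f b \<in> carrier (open_frame X)"
  by (simp add: open_frame_map_def openin_preimage)

lemma decode_open_frame_map:
  "b \<in> carrier (open_frame Y) \<Longrightarrow>
    X.decode (open_frame_map X Y f b) = {x \<in> topspace X. f x \<in> Y.decode b}"
  by (simp add: open_frame_map_def openin_preimage)

text \<open>Preimages commute with unions and finite intersections, and \<open>decode_inject\<close>
  carries these identities over to codes. Properness enters only for
  \<open>way_below\<close>.\<close>

sublocale pull: proper_homomorphism "open_frame Y" "open_frame X" "open_frame_map X Y f"
proof unfold_locales
  show "frame_hom (open_frame Y) (open_frame X) (open_frame_map X Y f)"
    unfolding frame_hom_def
  proof (intro conjI ballI allI impI)
    show "open_frame_map X Y f \<in> carrier (open_frame Y) \<rightarrow>\<^sub>E carrier (open_frame X)"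
      using open_frame_map_closed by (auto simp: PiE_iff) (simp add: open_frame_map_def)
    have "{x \<in> topspace X. f x \<in> topspace Y} = topspace X"
      using continuous_map_funspace[OF continuous] by auto
    then show "open_frame_map X Y f \<top>\<^bsub>open_frame Y\<^esub> = \<top>\<^bsub>open_frame X\<^esub>"
      by (subst X.decode_inject[symmetric])
        (auto simp: decode_open_frame_map Y.decode_top X.decode_top open_frame_map_closed)
  next
    fix a b assume "a \<in> carrier (open_frame Y)" "b \<in> carrier (open_frame Y)"
    then show "open_frame_map X Y f (a \<sqinter>\<^bsub>open_frame Y\<^esub> b) =
        open_frame_map X Y f a \<sqinter>\<^bsub>open_frame X\<^esub> open_frame_map X Y f b"
      by (subst X.decode_inject[symmetric])
        (auto simp: decode_open_frame_map Y.decode_meet X.decode_meet open_frame_map_closed)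
  next
    fix S assume S: "S \<subseteq> carrier (open_frame Y)"
    have S': "open_frame_map X Y f ` S \<subseteq> carrier (open_frame X)"
      using S open_frame_map_closed by auto
    have "X.decode (open_frame_map X Y f (\<Squnion>\<^bsub>open_frame Y\<^esub>S)) =
        {x \<in> topspace X. f x \<in> \<Union>(Y.decode ` S)}"
      using S by (simp add: decode_open_frame_map Y.decode_Sup)
    also have "\<dots> = (\<Union>s\<in>S. {x \<in> topspace X. f x \<in> Y.decode s})"
      by auto
    also have "\<dots> = (\<Union>s\<in>S. X.decode (open_frame_map X Y f s))"
      using S by (intro SUP_cong) (auto simp: decode_open_frame_map)
    also have "\<dots> = X.decode (\<Squnion>\<^bsub>open_frame X\<^esub>(open_frame_map X Y f ` S))"
      by (simp add: X.decode_Sup[OF S'] image_image)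
    finally show "open_frame_map X Y f (\<Squnion>\<^bsub>open_frame Y\<^esub>S) =
        \<Squnion>\<^bsub>open_frame X\<^esub>(open_frame_map X Y f ` S)"
      using S S' by (simp add: X.decode_inject open_frame_map_closed)
  qed
next
  fix a b assume ab: "a \<in> carrier (open_frame Y)" "b \<in> carrier (open_frame Y)"
    and "way_below (open_frame Y) a b"
  then obtain K where K: "compactin Y K" "Y.decode a \<subseteq> K" "K \<subseteq> Y.decode b"
    by (auto simp: Y.way_below_iff_compact_between)
  \<comment> \<open>The preimage of \<open>K\<close> lies between the preimages of the two open sets
    and thus witnesses that the first is way below the second.\<close>
  have "compactin X {x \<in> topspace X. f x \<in> K}"
    using proper K(1) by (simp add: Hausdorff_proper_continuous_map_iff[OF Y.Hausdorff])
  then show "way_below (open_frame X) (open_frame_map X Y f a) (open_frame_map X Y f b)"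
    using K ab
    by (intro X.way_below_if_compact_between) (auto simp: open_frame_map_closed decode_open_frame_map)
qed

end

lemma LCHaus_Hom_iff:
  assumes "X \<in> Obj LCHaus" "Y \<in> Obj LCHaus"
  shows "f \<in> Hom LCHaus X Y \<longleftrightarrow> proper_space_map X Y f \<and> f \<in> extensional (topspace X)"
  using assms unfolding LCHaus_Obj_iff
  by (auto simp: LCHaus_def proper_space_map_def proper_space_map_axioms_def)

text \<open>An arrow from \<open>X\<close> to \<open>Y\<close> in \<open>opposite LCHaus\<close> is
  a map from \<open>Y\<close> to \<open>X\<close>, hence the swapped object arguments of
  \<open>open_frame_map\<close>.\<close>

lemma is_functor_open_frame:
  "is_functor (opposite LCHaus) (ContRegFrm :: ('u gorder, 'u \<Rightarrow> 'u) precategory)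
     \<lparr>obj_map = open_frame, arr_map = (\<lambda>X Y. open_frame_map Y X)\<rparr>"
  unfolding is_functor_def functor_data.simps
proof (intro conjI ballI)
  fix X :: "'u topology" assume "X \<in> Obj (opposite LCHaus)"
  then interpret lchaus_space X by (simp add: opposite_def LCHaus_Obj_iff)
  show "open_frame X \<in> Obj ContRegFrm"
    by (simp add: ContRegFrm_Obj_iff continuous_regular_frame_axioms)
  have "{x \<in> topspace X. x \<in> decode b} = decode b" if "b \<in> carrier (open_frame X)" for b
    using openin_subset[OF openin_decode[OF that]] by auto
  then show "open_frame_map X X (Id (opposite LCHaus) X) = Id ContRegFrm (open_frame X)"
    by (auto simp: fun_eq_iff open_frame_map_def opposite_def LCHaus_def ContRegFrm_def cong: conj_cong)
next
  fix X Y :: "'u topology" and f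
  assume "X \<in> Obj (opposite LCHaus)" "Y \<in> Obj (opposite LCHaus)" "f \<in> Hom (opposite LCHaus) X Y"
  \<comment> \<open>The locale is instantiated with its spaces exchanged, so the prefix
    \<open>X.\<close> refers to the space \<open>Y\<close> and the prefix \<open>Y.\<close> to the
    space \<open>X\<close>.\<close>
  then interpret proper_space_map Y X f by (simp add: opposite_def LCHaus_Hom_iff)
  show "open_frame_map Y X f \<in> Hom ContRegFrm (open_frame X) (open_frame Y)"
    using pull.proper_homomorphism_axioms
    by (subst ContRegFrm_Hom_iff)
      (simp_all add: ContRegFrm_Obj_iff X.continuous_regular_frame_axioms
        Y.continuous_regular_frame_axioms, simp add: open_frame_map_def)
next
  fix X Y Z :: "'u topology" and f g
  assume "X \<in> Obj (opposite LCHaus)" "Y \<in> Obj (opposite LCHaus)" "Z \<in> Obj (opposite LCHaus)"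
    and "f \<in> Hom (opposite LCHaus) X Y" "g \<in> Hom (opposite LCHaus) Y Z"
  then interpret f: proper_space_map Y X f + g: proper_space_map Z Y g
    by (simp_all add: opposite_def LCHaus_Hom_iff)
  have "{z \<in> topspace Z. g z \<in> {y \<in> topspace Y. f y \<in> f.Y.decode a}} =
      {z \<in> topspace Z. compose (topspace Z) f g z \<in> f.Y.decode a}" for a
    using continuous_map_funspace[OF g.continuous] by (auto simp: compose_def)
  then show "open_frame_map Z X (Comp (opposite LCHaus) X Y Z g f) =
      Comp ContRegFrm (open_frame X) (open_frame Y) (open_frame Z)
        (open_frame_map Z Y g) (open_frame_map Y X f)"
    by (auto simp: fun_eq_iff opposite_def LCHaus_def ContRegFrm_def compose_def
        open_frame_map_def[of Z] f.open_frame_map_closed f.decode_open_frame_map cong: conj_cong)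
qed

section \<open>Unit and counit\<close>

definition frame_unit :: "'u gorder \<Rightarrow> 'u \<Rightarrow> 'u" where
  "frame_unit L = restrict (\<lambda>a. open_code (spectrum L) (basic_open L a)) (carrier L)"

definition space_counit :: "'u topology \<Rightarrow> 'u \<Rightarrow> 'u" where
  "space_counit X = restrict (\<lambda>x. open_code X (topspace X - {x})) (topspace X)"

context continuous_regular_frame
begin

interpretation sp: lchaus_space "spectrum L"
  using spectrum_in_LCHaus by (simp add: LCHaus_Obj_iff)

text \<open>Spatiality makes the map injective and order reflecting; it is surjective because every
  open set of the spectrum is basic.\<close>

lemma order_iso_frame_unit: "order_iso L (open_frame (spectrum L)) (frame_unit L)"
proof unfold_locales
  have "inj_on (frame_unit L) (carrier L)"
  proof (rule inj_onI)
    fix a b assume ab: "a \<in> carrier L" "b \<in> carrier L" "frame_unit L a = frame_unit L b"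
    then have "sp.decode (frame_unit L a) = sp.decode (frame_unit L b)"
      by simp
    then show "a = b"
      using ab by (intro le_antisym) (auto simp: frame_unit_def le_iff_basic_open_subset)
  qed
  moreover have "frame_unit L ` carrier L = carrier (open_frame (spectrum L))"
    by (auto simp: frame_unit_def sp.carrier_open_frame openin_spectrum)
  ultimately show "bij_betw (frame_unit L) (carrier L) (carrier (open_frame (spectrum L)))"
    by (simp add: bij_betw_def)
qed (simp add: frame_unit_def le_iff_basic_open_subset)

end

lemma natural_isomorphism_frame_unit:
  "natural_isomorphism ContRegFrm ContRegFrm identity_functor
     (compose_functors \<lparr>obj_map = open_frame, arr_map = (\<lambda>X Y. open_frame_map Y X)\<rparr>
       \<lparr>obj_map = spectrum, arr_map = spectrum_map\<rparr>)
     (frame_unit :: 'u gorder \<Rightarrow> 'u \<Rightarrow> 'u)"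
  unfolding natural_isomorphism_def compose_functors_def identity_functor_def functor_data.simps
proof (intro conjI ballI)
  fix L :: "'u gorder" assume "L \<in> Obj ContRegFrm"
  then interpret continuous_regular_frame L by (simp add: ContRegFrm_Obj_iff)
  show "isomorphism ContRegFrm L (open_frame (spectrum L)) (frame_unit L)"
    by (rule order_iso_imp_isomorphism[OF order_iso_frame_unit]) (simp add: frame_unit_def)
next
  fix L M :: "'u gorder" and h
  assume LM: "L \<in> Obj ContRegFrm" "M \<in> Obj ContRegFrm" and h: "h \<in> Hom ContRegFrm L M"
  then interpret proper_homomorphism L M h by (simp add: ContRegFrm_Hom_iff)
  interpret SL: lchaus_space "spectrum L"
    using L.spectrum_in_LCHaus by (simp add: LCHaus_Obj_iff)
  \<comment> \<open>Naturality at \<open>a\<close> says that the codes of these two open sets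
    agree.\<close>
  have "{q \<in> prime_elements M. spectrum_map L M h q \<in> basic_open L a} = basic_open M (h a)"
    if "a \<in> carrier L" for a
    using spectrum_map_in_basic_open_iff[OF _ that] by (auto simp: basic_open_def)
  then show "Comp ContRegFrm L M (open_frame (spectrum M)) (frame_unit M) h =
      Comp ContRegFrm L (open_frame (spectrum L)) (open_frame (spectrum M))
        (open_frame_map (spectrum M) (spectrum L) (spectrum_map L M h)) (frame_unit L)"
    by (auto simp: fun_eq_iff ContRegFrm_def compose_def frame_unit_def open_frame_map_def closed)
qed

text \<open>A homeomorphism is proper because the preimage of a compact set is its image under the
  continuous inverse.\<close>

lemma homeomorphic_imp_isomorphism:
  assumes XY: "X \<in> Obj LCHaus" "Y \<in> Obj LCHaus"
    and fg: "homeomorphic_maps X Y f g" and f: "f \<in> extensional (topspace X)"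
  shows "isomorphism (opposite LCHaus) Y X f"
proof -
  have proper: "proper_continuous_map X Y f"
    if "Hausdorff_space Y" "homeomorphic_maps X Y f g" for X Y :: "'u topology" and f g
    unfolding Hausdorff_proper_continuous_map_iff[OF that(1)]
  proof (intro conjI allI impI)
    show "continuous_map X Y f"
      using that(2) by (simp add: homeomorphic_maps_def)
    fix K assume K: "compactin Y K"
    have g: "continuous_map Y X g"
      and gf: "\<And>x. x \<in> topspace X \<Longrightarrow> g (f x) = x" and fg: "\<And>y. y \<in> topspace Y \<Longrightarrow> f (g y) = y"
      using that(2) by (simp_all add: homeomorphic_maps_def)
    have "x \<in> g ` K" if "x \<in> topspace X" "f x \<in> K" for x
      using gf[OF that(1)] that(2) by (metis imageI)
    moreover have "g y \<in> topspace X \<and> f (g y) \<in> K" if "y \<in> K" for y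
      using that compactin_subset_topspace[OF K] fg[of y] continuous_map_funspace[OF g] by auto
    ultimately have "{x \<in> topspace X. f x \<in> K} = g ` K"
      by auto
    then show "compactin X {x \<in> topspace X. f x \<in> K}"
      using image_compactin[OF K g] by simp
  qed
  \<comment> \<open>Arrows are extensional, so the inverse is cut off outside
    \<open>topspace Y\<close>.\<close>
  define g' where "g' = restrict g (topspace Y)"
  have fg': "homeomorphic_maps X Y f g'"
    by (rule homeomorphic_maps_eq[OF fg]) (simp_all add: g'_def)
  then have "homeomorphic_maps Y X g' f"
    by (rule homeomorphic_maps_sym[THEN iffD1])
  then have "f \<in> Hom LCHaus X Y" "g' \<in> Hom LCHaus Y X"
    using proper[OF _ fg'] proper[of X Y g' f] XY f by (auto simp: LCHaus_def g'_def)
  moreover have "compose (topspace X) g' f = (\<lambda>x\<in>topspace X. x)"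
    "compose (topspace Y) f g' = (\<lambda>x\<in>topspace Y. x)"
    using fg' by (auto simp: fun_eq_iff compose_def homeomorphic_maps_def)
  ultimately show ?thesis
    by (auto simp: isomorphism_def opposite_def LCHaus_def intro!: bexI[of _ g'])
qed

section \<open>The points of the frame of opens are the points of the space\<close>

context lchaus_space
begin

lemma openin_delete: "openin X (topspace X - {x})"
  using Hausdorff_imp_t1_space[OF Hausdorff] by (simp add: t1_space_openin_delete_alt)

lemma space_counit_closed: "x \<in> topspace X \<Longrightarrow> space_counit X x \<in> carrier (open_frame X)"
  by (simp add: space_counit_def openin_delete)

lemma decode_space_counit: "x \<in> topspace X \<Longrightarrow> decode (space_counit X x) = topspace X - {x}"
  by (simp add: space_counit_def openin_delete)

lemma le_space_counit_iff:
  assumes "x \<in> topspace X" "a \<in> carrier (open_frame X)"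
  shows "a \<sqsubseteq>\<^bsub>open_frame X\<^esub> space_counit X x \<longleftrightarrow> x \<notin> decode a"
  using assms openin_subset[OF openin_decode[OF assms(2)]] by (auto simp: decode_space_counit)

text \<open>By \<open>le_space_counit_iff\<close>, primality says that a point outside an
  intersection of two sets is outside one of them.\<close>

lemma space_counit_prime:
  assumes x: "x \<in> topspace X"
  shows "space_counit X x \<in> prime_elements (open_frame X)"
  unfolding prime_elements_def mem_Collect_eq
proof (intro conjI ballI impI)
  show "space_counit X x \<noteq> \<top>\<^bsub>open_frame X\<^esub>"
    using decode_space_counit[OF x] decode_top x by auto
qed (use x in \<open>auto simp: space_counit_closed le_space_counit_iff decode_meet simp del: le_open_frame\<close>)

text \<open>Hausdorff spaces are sober: the complement of a prime open set is irreducible, so it cannot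
  contain two points with disjoint neighbourhoods.\<close>

lemma prime_eq_space_counit:
  assumes p: "p \<in> prime_elements (open_frame X)"
  shows "\<exists>x\<in>topspace X. p = space_counit X x"
proof -
  have pc: "p \<in> carrier (open_frame X)" and ptop: "p \<noteq> \<top>\<^bsub>open_frame X\<^esub>"
    and prime: "\<And>a b. \<lbrakk>a \<in> carrier (open_frame X); b \<in> carrier (open_frame X);
      a \<sqinter>\<^bsub>open_frame X\<^esub> b \<sqsubseteq>\<^bsub>open_frame X\<^esub> p\<rbrakk>
      \<Longrightarrow> a \<sqsubseteq>\<^bsub>open_frame X\<^esub> p \<or> b \<sqsubseteq>\<^bsub>open_frame X\<^esub> p"
    using p by (auto simp: prime_elements_def simp del: le_open_frame)
  have sub: "decode p \<subseteq> topspace X"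
    using openin_subset[OF openin_decode[OF pc]] .
  have "decode p \<noteq> topspace X"
    using decode_inject[OF pc top_closed] ptop decode_top by auto
  then obtain x where x: "x \<in> topspace X" "x \<notin> decode p"
    using sub by auto
  have "y \<in> decode p" if y: "y \<in> topspace X" "y \<noteq> x" for y
  proof (rule ccontr)
    assume "y \<notin> decode p"
    obtain U V where UV: "openin X U" "openin X V" "x \<in> U" "y \<in> V" "disjnt U V"
      using Hausdorff x(1) y unfolding Hausdorff_space_def by metis
    \<comment> \<open>The meet of the codes of \<open>U\<close> and \<open>V\<close> is empty, hence
      below \<open>p\<close>, and primality puts one of the two neighbourhoods inside
      \<open>decode p\<close>.\<close>
    then have "U \<subseteq> decode p \<or> V \<subseteq> decode p"
      using prime[of "code U" "code V"] by (auto simp: decode_meet disjnt_def)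
    then show False
      using UV x \<open>y \<notin> decode p\<close> by auto
  qed
  then have "decode p = topspace X - {x}"
    using sub x by auto
  then have "p = space_counit X x"
    using x pc by (subst decode_inject[symmetric]) (simp_all add: decode_space_counit space_counit_closed)
  then show ?thesis
    using x by blast
qed

text \<open>By \<open>mem\<close>, the opens \<open>decode a\<close> and
  \<open>basic_open (open_frame X) a\<close> correspond to each other, which gives continuity and
  openness. Surjectivity is sobriety, in the form of \<open>prime_eq_space_counit\<close>.\<close>

lemma homeomorphic_space_counit:
  "homeomorphic_map X (spectrum (open_frame X)) (space_counit X)"
proof (rule bijective_open_imp_homeomorphic_map)
  have mem: "space_counit X x \<in> basic_open (open_frame X) a \<longleftrightarrow> x \<in> decode a"
    if "x \<in> topspace X" "a \<in> carrier (open_frame X)" for x a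
    using that by (simp add: basic_open_def space_counit_prime le_space_counit_iff del: le_open_frame)
  show img: "space_counit X ` topspace X = topspace (spectrum (open_frame X))"
    using space_counit_prime prime_eq_space_counit by fastforce
  show "inj_on (space_counit X) (topspace X)"
  proof (rule inj_onI)
    fix x y assume xy: "x \<in> topspace X" "y \<in> topspace X" "space_counit X x = space_counit X y"
    then have "topspace X - {x} = topspace X - {y}"
      by (metis decode_space_counit)
    then show "x = y"
      using xy by auto
  qed
  show "continuous_map X (spectrum (open_frame X)) (space_counit X)"
    unfolding continuous_map_def
  proof (intro conjI allI impI)
    fix U assume "openin (spectrum (open_frame X)) U"
    then obtain a where a: "a \<in> carrier (open_frame X)" "U = basic_open (open_frame X) a"
      by (auto simp: openin_spectrum)
    then have "{x \<in> topspace X. space_counit X x \<in> U} = decode a"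
      using mem openin_subset[OF openin_decode[OF a(1)]] by auto
    then show "openin X {x \<in> topspace X. space_counit X x \<in> U}"
      using a by simp
  qed (use space_counit_prime in auto)
  show "open_map X (spectrum (open_frame X)) (space_counit X)"
    unfolding open_map_def
  proof (intro allI impI)
    fix U assume U: "openin X U"
    have "space_counit X ` U = basic_open (open_frame X) (code U)"
    proof
      show "space_counit X ` U \<subseteq> basic_open (open_frame X) (code U)"
        using mem U openin_subset[OF U] by auto
      show "basic_open (open_frame X) (code U) \<subseteq> space_counit X ` U"
      proof
        fix p assume p: "p \<in> basic_open (open_frame X) (code U)"
        then obtain x where "x \<in> topspace X" "p = space_counit X x"
          using prime_eq_space_counit by (auto simp: basic_open_def)
        then show "p \<in> space_counit X ` U"
          using mem[of x "code U"] p U by auto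
      qed
    qed
    then show "openin (spectrum (open_frame X)) (space_counit X ` U)"
      using U by simp
  qed
qed

end

text \<open>The component at \<open>X\<close> is a map from \<open>X\<close> to its double dual,
  which the opposite category reads as an arrow into \<open>X\<close>.\<close>

lemma natural_isomorphism_space_counit:
  "natural_isomorphism (opposite LCHaus) (opposite LCHaus)
     (compose_functors \<lparr>obj_map = spectrum, arr_map = spectrum_map\<rparr>
       \<lparr>obj_map = open_frame, arr_map = (\<lambda>X Y. open_frame_map Y X)\<rparr>)
     identity_functor (space_counit :: 'u topology \<Rightarrow> 'u \<Rightarrow> 'u)"
  unfolding natural_isomorphism_def compose_functors_def identity_functor_def functor_data.simps
proof (intro conjI ballI)
  fix X :: "'u topology" assume X: "X \<in> Obj (opposite LCHaus)"
  then interpret lchaus_space X by (simp add: opposite_def LCHaus_Obj_iff)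
  obtain g where "homeomorphic_maps X (spectrum (open_frame X)) (space_counit X) g"
    using homeomorphic_space_counit by (auto simp: homeomorphic_map_maps)
  then show "isomorphism (opposite LCHaus) (spectrum (open_frame X)) X (space_counit X)"
    using X spectrum_in_LCHaus
    by (intro homeomorphic_imp_isomorphism) (auto simp: opposite_def space_counit_def)
next
  fix X Y :: "'u topology" and f
  assume "X \<in> Obj (opposite LCHaus)" "Y \<in> Obj (opposite LCHaus)" "f \<in> Hom (opposite LCHaus) X Y"
  then interpret proper_space_map Y X f by (simp add: opposite_def LCHaus_Hom_iff)
  have fy: "f y \<in> topspace X" if "y \<in> topspace Y" for y
    using continuous_map_funspace[OF continuous] that by auto
  have "spectrum_map (open_frame X) (open_frame Y) (open_frame_map Y X f) (space_counit Y y) =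
      space_counit X (f y)" if y: "y \<in> topspace Y" for y
  proof (rule Y.eq_if_same_lower)
    fix a assume a: "a \<in> carrier (open_frame X)"
    show "a \<sqsubseteq>\<^bsub>open_frame X\<^esub> spectrum_map (open_frame X) (open_frame Y) (open_frame_map Y X f) (space_counit Y y)
        \<longleftrightarrow> a \<sqsubseteq>\<^bsub>open_frame X\<^esub> space_counit X (f y)"
      \<comment> \<open>Both sides reduce to \<open>f y\<close> lying outside the open set coded by
        \<open>a\<close>. The prefixes \<open>X.\<close> and \<open>Y.\<close> again refer to the
        spaces \<open>Y\<close> and \<open>X\<close>.\<close>
      unfolding pull.le_spectrum_map_iff[OF X.space_counit_prime[OF y] a]
        X.le_space_counit_iff[OF y pull.closed[OF a]] Y.le_space_counit_iff[OF fy[OF y] a]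
      using y a by (simp add: decode_open_frame_map)
  qed (use y fy in \<open>simp_all add: pull.spectrum_map_closed X.space_counit_prime Y.space_counit_closed\<close>)
  then show "Comp (opposite LCHaus) (spectrum (open_frame X)) (spectrum (open_frame Y)) Y
        (space_counit Y) (spectrum_map (open_frame X) (open_frame Y) (open_frame_map Y X f)) =
      Comp (opposite LCHaus) (spectrum (open_frame X)) X Y f (space_counit X)"
    by (auto simp: fun_eq_iff opposite_def LCHaus_def compose_def)
qed

theorem corollary6p10:
  shows "dually_equivalent
    (ContRegFrm :: ('u gorder, 'u \<Rightarrow> 'u) precategory)
    (LCHaus :: ('u topology, 'u \<Rightarrow> 'u) precategory)"
  unfolding dually_equivalent_def equivalent_categories_def
  using category_ContRegFrm category_opposite[OF category_LCHaus] is_functor_spectrum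
    is_functor_open_frame natural_isomorphism_frame_unit natural_isomorphism_space_counit
  by blast

end
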